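(* For $n\ge 3$ let $D_n=|D(x_1,\ldots,x_n)|$, where $x_1,\ldots,x_n\in\mathbb{R}^3$ are the vertices of a regular $n$-gon. Then $$\lim_{n\to\infty}\frac{\ln D_n}{n^2}=\frac{7\zeta(3)}{2\pi^2}-\frac{\ln 2}{2}=0.07970479\ldots$$ and $D_n>1$ for all $n\ge 3$.
   Context: $\zeta$ is the Riemann zeta function. $D$ denotes the Atiyah determinant, defined as follows. Let $x_1,\ldots,x_n$ be distinct points of $\mathbb{R}^3$, with $x_i=(x_{i,1},x_{i,2},x_{i,3})$. For each pair $i<j$ choose complex numbers $z_{i,j},w_{i,j}$ with $|z_{i,j}|^2+|w_{i,j}|^2=1$ and $$\frac{z_{i,j}}{w_{i,j}}=\frac{(x_{j,1}-x_{i,1})+(x_{j,2}-x_{i,2})\sqrt{-1}}{\sqrt{\sum_{k=1}^3(x_{j,k}-x_{i,k})^2}-(x_{j,3}-x_{i,3})},$$ with the convention that $w_{i,j}=0$ when the denominator of the right-hand side vanishes. For $i>j$ put $z_{i,j}=-\overline{w_{j,i}}$ and $w_{i,j}=\overline{z_{j,i}}$. Let $a_{i,j}$ be the coefficient of $t_1^{j-1}t_2^{n-j}$ in the polynomial $f_i(t_1,t_2)=\prod_{k\ne i}(z_{i,k}t_1-w_{i,k}t_2)$. Then $D(x_1,\ldots,x_n)=\det(a_{i,j})_{1\le i,j\le n}$; this number is known to be independent of the choices made. It is also invariant under orientation-preserving similitudes of $\mathbb{R}^3$, and becomes its complex conjugate under orientation-reversing ones, so $D_n$ depends only on $n$.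
   Formalization: The printed decimal 0.07970479… is incorrect: the constant 7ζ(3)/(2π²) − ln 2/2 equals 0.0797048085…, and the formal statement asserts 0.07970480 ≤ constant < 0.07970481 instead. *)

theory Defs
  imports
    "HOL-Analysis.Analysis"
    "HOL-Computational_Algebra.Polynomial"
    "Jordan_Normal_Form.Determinant"
begin

text \<open>The Riemann zeta function on the half-line \<open>s > 1\<close>, where its Dirichlet series converges;
  values at other arguments carry no meaning.\<close>

definition riemann_zeta :: "real \<Rightarrow> real" where
  "riemann_zeta s = (\<Sum>n. 1 / real (Suc n) powr s)"

text \<open>A point configuration is a function \<open>x\<close> of which only the values on \<open>{1..n}\<close> matter, and
  likewise \<open>z\<close>, \<open>w\<close> matter only at pairs of distinct indices in \<open>{1..n}\<close>.
  Since division by zero is \<open>0\<close> in HOL, \<open>w i j \<noteq> 0\<close> is required explicitly whenever the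
  denominator of the prescribed ratio does not vanish: otherwise \<open>w i j = 0\<close> would be
  admitted when that ratio is \<open>0\<close>.\<close>

definition atiyah_choice ::
    "nat \<Rightarrow> (nat \<Rightarrow> real ^ 3) \<Rightarrow> (nat \<Rightarrow> nat \<Rightarrow> complex) \<Rightarrow> (nat \<Rightarrow> nat \<Rightarrow> complex) \<Rightarrow> bool" where
  "atiyah_choice n x z w \<longleftrightarrow>
     (\<forall>i\<in>{1..n}. \<forall>j\<in>{1..n}. i < j \<longrightarrow>
        (let d = x j - x i; q = norm d - vec_nth d 3 in
          (cmod (z i j))\<^sup>2 + (cmod (w i j))\<^sup>2 = 1 \<and>
          (if q = 0 then w i j = 0
           else w i j \<noteq> 0 \<and>
             z i j / w i j = Complex (vec_nth d 1) (vec_nth d 2) / complex_of_real q))) \<and>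
     (\<forall>i\<in>{1..n}. \<forall>j\<in>{1..n}. j < i \<longrightarrow> z i j = - cnj (w j i) \<and> w i j = cnj (z j i))"

text \<open>\<open>\<complex>[t\<^sub>1, t\<^sub>2]\<close> is represented as \<open>\<complex>[t\<^sub>2][t\<^sub>1]\<close>: the outer variable is \<open>t\<^sub>1\<close>, the inner one \<open>t\<^sub>2\<close>.\<close>

definition t1 :: "complex poly poly" where "t1 = [:0, 1:]"

definition t2 :: "complex poly poly" where "t2 = [:[:0, 1:]:]"

definition atiyah_poly ::
    "nat \<Rightarrow> (nat \<Rightarrow> nat \<Rightarrow> complex) \<Rightarrow> (nat \<Rightarrow> nat \<Rightarrow> complex) \<Rightarrow> nat \<Rightarrow> complex poly poly" where
  "atiyah_poly n z w i =
     (\<Prod>k\<in>{1..n} - {i}. [:[:z i k:]:] * t1 - [:[:w i k:]:] * t2)"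

definition atiyah_coeff ::
    "nat \<Rightarrow> (nat \<Rightarrow> nat \<Rightarrow> complex) \<Rightarrow> (nat \<Rightarrow> nat \<Rightarrow> complex) \<Rightarrow> nat \<Rightarrow> nat \<Rightarrow> complex" where
  "atiyah_coeff n z w i j =
     poly.coeff (poly.coeff (atiyah_poly n z w i) (j - 1)) (n - j)"

text \<open>Rows and columns of a \<open>mat\<close> are numbered from 0, hence the shift by one. The description
  is definite because the determinant does not depend on the choice of \<open>z\<close> and \<open>w\<close>.\<close>

definition atiyah_det :: "nat \<Rightarrow> (nat \<Rightarrow> real ^ 3) \<Rightarrow> complex" where
  "atiyah_det n x =
     (THE d. \<exists>z w. atiyah_choice n x z w \<and>
        d = Determinant.det (mat n n (\<lambda>(i, j). atiyah_coeff n z w (i + 1) (j + 1))))"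

text \<open>\<open>x 1, \<dots>, x n\<close> are, listed in any order, the vertices of a regular \<open>n\<close>-gon with centre \<open>c\<close>
  and circumradius \<open>r\<close>, lying in the plane through \<open>c\<close> with orthonormal directions \<open>u\<close>, \<open>v\<close>.\<close>

definition regular_polygon_vertices :: "nat \<Rightarrow> (nat \<Rightarrow> real ^ 3) \<Rightarrow> bool" where
  "regular_polygon_vertices n x \<longleftrightarrow>
     (\<exists>c u v r. r > 0 \<and> norm u = 1 \<and> norm v = 1 \<and> u \<bullet> v = 0 \<and>
        bij_betw x {1..n}
          ((\<lambda>k. c + r *\<^sub>R (cos (2 * pi * real k / real n) *\<^sub>R u
                        + sin (2 * pi * real k / real n) *\<^sub>R v)) ` {..<n}))"

end

theory Submission
  imports Defs "HOL-Real_Asymp.Real_Asymp"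
begin

text \<open>
  The direction from one vertex of a regular polygon to another lies on the great circle of
  directions of its plane. A Hopf lift of a unit direction \<open>d\<close> is a unit vector \<open>(z, w)\<close> of
  \<open>\<complex>\<^sup>2\<close> in the fibre over \<open>d\<close>; the numbers that enter the Atiyah determinant are exactly such lifts, and they are
  unique up to a phase (\<open>hopf_lift_sgn_iff\<close>, \<open>hopf_lift_phase\<close>). Along a great circle the lifts are
  \<open>cos (\<phi>/2) a + sin (\<phi>/2) b\<close> with \<open>a, b\<close> an orthonormal basis of \<open>\<complex>\<^sup>2\<close>
  (\<open>great_circle_lift\<close>), hence the linear factors of the polynomials are, up to phases and a factor
  \<open>1/\<surd>2\<close>, of the form \<open>A + cis \<phi> B\<close> with \<open>(A, B)\<close> a unitary change of the variables
  \<open>(t\<^sub>1, t\<^sub>2)\<close>. A unitary substitution does not change the modulus of the determinant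
  (\<open>cmod_det_unitary_forms\<close>); this takes the place of rotating the polygon into a standard plane.

  With \<open>\<zeta> = cis (\<pi>/n)\<close> and \<open>\<omega> = \<zeta>\<^sup>2\<close>, the directions seen from the vertex number \<open>a\<close> give
  \<open>cis \<phi> = \<i> \<omega>\<^sup>a \<zeta>\<^sup>s\<close> for \<open>s = 1, \<dots>, n - 1\<close>. So row \<open>a\<close> is, up to a
  scalar, the homogenized polynomial \<open>\<Prod>\<^sub>s (1 + \<zeta>\<^sup>s y)\<close> at \<open>y = \<i> \<omega>\<^sup>a B / A\<close>. Expressed in the monomials in
  \<open>A\<close> and \<open>B\<close>, the coefficient matrix is a product of diagonal matrices and the discrete Fourier
  matrix, with its rows in the order of the given numbering of the vertices. The coefficients \<open>g\<^sub>m\<close> of this polynomial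
  satisfy \<open>(1 - \<zeta>\<^sup>m) g\<^sub>m = (1 + \<zeta>\<^sup>m) g\<^sub>m\<^sub>-\<^sub>1\<close>, so their moduli are products of cotangents, and
  \[ D_n = n^{n/2} 2^{-n(n-1)/2} \prod_{j=1}^{n-1} \cot(\pi j/2n)^{n-j}. \]

  Taking logarithms and pairing \<open>j\<close> with \<open>n - j\<close> turns the last factor into the Riemann sum
  \<open>(n/2) \<Sum>\<^sub>j f (j/n)\<close> of \<open>f(t) = (1 - 2t) ln cot (\<pi>t/2)\<close>. This function is convex and symmetric on
  \<open>(0, 1)\<close>. The Fourier series \<open>ln cot (\<pi>t/2) = \<Sum> 2 cos (k\<pi>t)/k\<close> over odd \<open>k\<close>, integrated twice,
  gives an explicit primitive of \<open>f\<close> and shows that the integral of \<open>f\<close> over the unit interval is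
  \<open>7 riemann_zeta 3 / \<pi>\<^sup>2\<close>. By convexity the midpoint rule bounds the sum from above and the
  trapezoidal rule bounds it from below (\<open>log_polygon_det_le\<close>, \<open>log_polygon_det_ge\<close>). Both bounds have
  the same leading term, which gives the limit. The lower bound is explicit enough to give \<open>D_n > 1\<close> for \<open>n \<ge> 5\<close>;
  the values for \<open>n = 3\<close> and \<open>n = 4\<close> are elementary.
\<close>

section \<open>Linear forms, coefficients and determinants\<close>

lemma degree_prod_linear_le:
  fixes a b :: "'i \<Rightarrow> 'a :: comm_semiring_1"
  assumes "finite K"
  shows "degree (\<Prod>k\<in>K. [:a k, b k:]) \<le> card K"
proof -
  have "degree (\<Prod>k\<in>K. [:a k, b k:]) \<le> sum (degree \<circ> (\<lambda>k. [:a k, b k:])) K"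
    by (rule degree_prod_sum_le[OF assms])
  also have "\<dots> \<le> (\<Sum>k\<in>K. 1)" by (rule sum_mono) simp
  finally show ?thesis by simp
qed

text \<open>A product of linear forms is homogeneous, so setting \<open>t\<^sub>2 = 1\<close> loses nothing: the bivariate
  coefficients are those of an ordinary polynomial.\<close>

lemma coeff_coeff_prod_linear_forms:
  assumes "finite K"
  shows "poly.coeff (poly.coeff (\<Prod>k\<in>K. [:[:z k:]:] * t1 - [:[:w k:]:] * t2) m) l =
     (if m + l = card K then poly.coeff (\<Prod>k\<in>K. [:- w k, z k:]) m else 0)"
proof -
  have "(\<Prod>k\<in>K. [:[:z k:]:] * t1 - [:[:w k:]:] * t2) = (\<Prod>k\<in>K. [:[:0, - w k:], [:z k:]:])"
    by (rule prod.cong) (simp_all add: t1_def t2_def)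
  moreover have "poly.coeff (poly.coeff (\<Prod>k\<in>K. [:[:0, - w k:], [:z k:]:]) m) l =
     (if m + l = card K then poly.coeff (\<Prod>k\<in>K. [:- w k, z k:]) m else 0)"
    using assms
  proof (induction K arbitrary: m l rule: finite_induct)
    case empty
    then show ?case by (cases m; cases l) (auto simp: one_pCons)
  next
    case (insert a K)
    have top: "poly.coeff (\<Prod>k\<in>K. [:- w k, z k:]) (Suc (card K)) = 0"
      using degree_prod_linear_le[OF insert.hyps(1), of "\<lambda>k. - w k" z] by (intro coeff_eq_0) simp
    show ?case
      unfolding prod.insert[OF insert.hyps] card_insert_disjoint[OF insert.hyps]
      by (cases m; cases l) (auto simp: insert.IH top)
  qed
  ultimately show ?thesis by simp
qed

definition row_poly :: "nat \<Rightarrow> (nat \<Rightarrow> nat \<Rightarrow> complex) \<Rightarrow> (nat \<Rightarrow> nat \<Rightarrow> complex) \<Rightarrow> nat \<Rightarrow> complex poly" where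
  "row_poly n z w i = (\<Prod>k\<in>{1..n} - {i}. [:- w i k, z i k:])"

lemma atiyah_coeff_eq:
  assumes "i \<in> {1..n}" "j \<in> {1..n}"
  shows "atiyah_coeff n z w i j = poly.coeff (row_poly n z w i) (j - 1)"
  unfolding atiyah_coeff_def atiyah_poly_def row_poly_def
    coeff_coeff_prod_linear_forms[OF finite_Diff[OF finite_atLeastAtMost]]
  using assms by simp

lemma poly_row_poly: "poly (row_poly n z w i) t = (\<Prod>k\<in>{1..n} - {i}. z i k * t - w i k)"
  by (simp add: row_poly_def poly_prod algebra_simps)

lemma poly_row_poly_sum:
  assumes "i \<in> {1..n}"
  shows "poly (row_poly n z w i) t = (\<Sum>m<n. poly.coeff (row_poly n z w i) m * t ^ m)"
proof -
  have "degree (row_poly n z w i) \<le> n - 1"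
    unfolding row_poly_def using degree_prod_linear_le[of "{1..n} - {i}" "\<lambda>k. - w i k" "z i"] assms by simp
  then have "(\<Sum>m<n. poly.coeff (row_poly n z w i) m * t ^ m)
      = (\<Sum>m\<le>degree (row_poly n z w i). poly.coeff (row_poly n z w i) m * t ^ m)"
    using assms by (intro sum.mono_neutral_right) (auto simp: coeff_eq_0)
  then show ?thesis by (simp add: poly_altdef)
qed

definition atiyah_mat :: "nat \<Rightarrow> (nat \<Rightarrow> nat \<Rightarrow> complex) \<Rightarrow> (nat \<Rightarrow> nat \<Rightarrow> complex) \<Rightarrow> complex mat" where
  "atiyah_mat n z w = mat n n (\<lambda>(i, j). atiyah_coeff n z w (i + 1) (j + 1))"

lemma atiyah_mat_eq: "atiyah_mat n z w = mat n n (\<lambda>(i, j). poly.coeff (row_poly n z w (i + 1)) j)"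
  unfolding atiyah_mat_def by (rule cong_mat) (auto simp: atiyah_coeff_eq)

lemma det_mat_Leibniz:
  "Determinant.det (mat n n (\<lambda>(i, j). a i j)) = (\<Sum>p | p permutes {0..<n}. signof p * (\<Prod>i<n. a i (p i)))"
proof -
  have "Determinant.det (mat n n (\<lambda>(i, j). a i j))
    = (\<Sum>p | p permutes {0..<n}. signof p * (\<Prod>i = 0..<n. mat n n (\<lambda>(i, j). a i j) $$ (i, p i)))"
    by (rule det_def') simp
  also have "\<dots> = (\<Sum>p | p permutes {0..<n}. signof p * (\<Prod>i<n. a i (p i)))"
  proof (rule sum.cong[OF refl])
    fix p assume "p \<in> {p. p permutes {0..<n}}"
    then have "p i < n" if "i < n" for i using that permutes_in_image[of p "{0..<n}" i] by simp
    then show "signof p * (\<Prod>i = 0..<n. mat n n (\<lambda>(i, j). a i j) $$ (i, p i)) = signof p * (\<Prod>i<n. a i (p i))"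
      by (intro arg_cong2[where f = "(*)"] prod.cong) auto
  qed
  finally show ?thesis .
qed

lemma det_scale_rows:
  fixes c :: "nat \<Rightarrow> 'a :: comm_ring_1"
  shows "Determinant.det (mat n n (\<lambda>(i, j). c i * a i j)) = (\<Prod>i<n. c i) * Determinant.det (mat n n (\<lambda>(i, j). a i j))"
  unfolding det_mat_Leibniz by (simp add: prod.distrib sum_distrib_left mult_ac)

lemma det_cnj: "Determinant.det (mat n n (\<lambda>(i, j). cnj (a i j))) = cnj (Determinant.det (mat n n (\<lambda>(i, j). a i j)))"
proof -
  interpret comm_ring_hom cnj by unfold_locales auto
  have "mat n n (\<lambda>(i, j). cnj (a i j)) = map_mat cnj (mat n n (\<lambda>(i, j). a i j))" by auto
  then show ?thesis by simp
qed

text \<open>The weighted Gram matrix \<open>A\<^sup>* C A\<close> determines \<open>|det A|\<close>, because its determinant is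
  \<open>det C |det A|\<^sup>2\<close>. In this way the modulus of a determinant is found by
  exhibiting a simpler matrix with the same Gram matrix.\<close>

lemma cmod_det_eq_of_gram:
  fixes A B :: "nat \<Rightarrow> nat \<Rightarrow> complex" and C :: "nat \<Rightarrow> real"
  assumes C: "\<And>m. m < n \<Longrightarrow> C m > 0"
    and gram: "\<And>k l. k < n \<Longrightarrow> l < n \<Longrightarrow>
      (\<Sum>m<n. of_real (C m) * cnj (A m k) * A m l) = (\<Sum>m<n. of_real (C m) * cnj (B m k) * B m l)"
  shows "cmod (Determinant.det (mat n n (\<lambda>(i, j). A i j))) = cmod (Determinant.det (mat n n (\<lambda>(i, j). B i j)))"
proof -
  define G where "G A = mat n n (\<lambda>(k, l). \<Sum>m<n. of_real (C m) * cnj (A m k) * A m l)" for A :: "nat \<Rightarrow> nat \<Rightarrow> complex"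
  have det_G: "Determinant.det (G A) = of_real ((\<Prod>m<n. C m) * (cmod (Determinant.det (mat n n (\<lambda>(i, j). A i j))))\<^sup>2)" for A
  proof -
    have "G A = transpose_mat (mat n n (\<lambda>(m, k). of_real (C m) * cnj (A m k))) * mat n n (\<lambda>(i, j). A i j)"
      unfolding G_def by (rule eq_matI) (auto simp: scalar_prod_def atLeast0LessThan)
    then have "Determinant.det (G A) = Determinant.det (mat n n (\<lambda>(m, k). of_real (C m) * cnj (A m k)))
        * Determinant.det (mat n n (\<lambda>(i, j). A i j))"
      by (simp add: det_mult[of _ n] det_transpose[of _ n])
    also have "\<dots> = of_real (\<Prod>m<n. C m) * (Determinant.det (mat n n (\<lambda>(i, j). A i j)) * cnj (Determinant.det (mat n n (\<lambda>(i, j). A i j))))"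
      unfolding det_scale_rows det_cnj by (simp add: mult_ac)
    also have "\<dots> = of_real ((\<Prod>m<n. C m) * (cmod (Determinant.det (mat n n (\<lambda>(i, j). A i j))))\<^sup>2)"
      by (simp only: complex_norm_square[symmetric] of_real_mult)
    finally show ?thesis .
  qed
  define P where "P = (\<Prod>m<n. C m)"
  have "G A = G B" unfolding G_def by (rule cong_mat) (auto simp: gram)
  then have eq: "P * (cmod (Determinant.det (mat n n (\<lambda>(i, j). A i j))))\<^sup>2
     = P * (cmod (Determinant.det (mat n n (\<lambda>(i, j). B i j))))\<^sup>2"
    using det_G[of A] det_G[of B] unfolding P_def by (simp only: of_real_eq_iff)
  have "P > 0" unfolding P_def using C by (intro prod_pos) auto
  then have "P \<noteq> 0" by simp
  from mult_left_cancel[OF this] eq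
  have "(cmod (Determinant.det (mat n n (\<lambda>(i, j). A i j))))\<^sup>2
     = (cmod (Determinant.det (mat n n (\<lambda>(i, j). B i j))))\<^sup>2" by blast
  then show ?thesis by (rule power2_eq_imp_eq) simp_all
qed

section \<open>Hopf lifts and the independence of the determinant from the choices\<close>

text \<open>The Hopf map sends a unit vector \<open>(z, w)\<close> of \<open>\<complex>\<^sup>2\<close> to the point of the unit sphere with first two
  coordinates \<open>2 z \<cdot> cnj w\<close> and third coordinate \<open>|z|\<^sup>2 - |w|\<^sup>2\<close>. Conjugates are used instead of
  moduli so that the conditions are polynomial identities.\<close>

definition hopf_lift :: "complex \<Rightarrow> complex \<Rightarrow> real ^ 3 \<Rightarrow> bool" where
  "hopf_lift z w d \<longleftrightarrow> 2 * z * cnj w = Complex (vec_nth d 1) (vec_nth d 2)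
     \<and> z * cnj z + w * cnj w = 1 \<and> z * cnj z - w * cnj w = of_real (vec_nth d 3)"

lemma norm_vec3: "(norm (d :: real ^ 3))\<^sup>2 = (vec_nth d 1)\<^sup>2 + (vec_nth d 2)\<^sup>2 + (vec_nth d 3)\<^sup>2"
  unfolding power2_norm_eq_inner by (simp add: inner_vec_def sum_3 power2_eq_square)

lemma hopf_lift_iff:
  "hopf_lift z w d \<longleftrightarrow> 2 * z * cnj w = Complex (vec_nth d 1) (vec_nth d 2)
     \<and> (cmod z)\<^sup>2 = (1 + vec_nth d 3) / 2 \<and> (cmod w)\<^sup>2 = (1 - vec_nth d 3) / 2"
proof -
  have "z * cnj z + w * cnj w = of_real ((cmod z)\<^sup>2 + (cmod w)\<^sup>2)"
    "z * cnj z - w * cnj w = of_real ((cmod z)\<^sup>2 - (cmod w)\<^sup>2)"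
    by (simp_all only: complex_norm_square of_real_add of_real_diff)
  then have "hopf_lift z w d \<longleftrightarrow> 2 * z * cnj w = Complex (vec_nth d 1) (vec_nth d 2)
     \<and> (cmod z)\<^sup>2 + (cmod w)\<^sup>2 = 1 \<and> (cmod z)\<^sup>2 - (cmod w)\<^sup>2 = vec_nth d 3"
    unfolding hopf_lift_def by (metis of_real_1 of_real_eq_iff)
  also have "\<dots> \<longleftrightarrow> 2 * z * cnj w = Complex (vec_nth d 1) (vec_nth d 2)
     \<and> (cmod z)\<^sup>2 = (1 + vec_nth d 3) / 2 \<and> (cmod w)\<^sup>2 = (1 - vec_nth d 3) / 2"
    by auto
  finally show ?thesis .
qed

text \<open>The prescribed ratio \<open>z / w\<close> is the stereographic projection of the direction \<open>d / |d|\<close>, and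
  stereographic projection composed with the Hopf map is \<open>(z, w) \<mapsto> z / w\<close>. The north pole is the case
  \<open>q = 0\<close>.\<close>

lemma hopf_lift_sgn_iff:
  fixes d :: "real ^ 3"
  assumes "d \<noteq> 0"
  defines "q \<equiv> norm d - vec_nth d 3"
  shows "hopf_lift z w (sgn d) \<longleftrightarrow> (cmod z)\<^sup>2 + (cmod w)\<^sup>2 = 1 \<and>
     (if q = 0 then w = 0 else w \<noteq> 0 \<and> z / w = Complex (vec_nth d 1) (vec_nth d 2) / complex_of_real q)"
    (is "?L \<longleftrightarrow> ?R")
proof -
  define r where "r = norm d"
  have r: "r > 0" using assms by (simp add: r_def)
  define c where "c = Complex (vec_nth d 1) (vec_nth d 2)"
  have cc: "(cmod c)\<^sup>2 = (r + vec_nth d 3) * q"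
  proof -
    have "(cmod c)\<^sup>2 = (vec_nth d 1)\<^sup>2 + (vec_nth d 2)\<^sup>2" by (simp add: c_def cmod_def)
    also have "\<dots> = r\<^sup>2 - (vec_nth d 3)\<^sup>2" using norm_vec3[of d] by (simp add: r_def)
    finally show ?thesis by (simp add: q_def r_def power2_eq_square algebra_simps)
  qed
  have q: "q \<ge> 0" using component_le_norm_cart[of d 3] by (auto simp: q_def)
  have s: "vec_nth (sgn d) i = vec_nth d i / r" for i
    by (simp add: sgn_div_norm r_def divide_inverse mult.commute)
  have s': "Complex (vec_nth (sgn d) 1) (vec_nth (sgn d) 2) = c / of_real r"
    by (simp add: s c_def complex_eq_iff)
  have d3: "vec_nth d 3 = r - q" by (simp add: q_def r_def)
  show ?thesis
  proof
    assume ?L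
    then have L: "2 * z * cnj w = c / of_real r" "(cmod z)\<^sup>2 = (1 + vec_nth d 3 / r) / 2" "(cmod w)\<^sup>2 = (1 - vec_nth d 3 / r) / 2"
      unfolding hopf_lift_iff s' unfolding s by auto
    have w: "(cmod w)\<^sup>2 = q / (2 * r)" using L(3) r by (simp add: d3 field_simps)
    have "z / w = c / of_real q" if "q \<noteq> 0"
    proof -
      have w0: "w \<noteq> 0" using w that r by auto
      have "w * cnj w = of_real (q / (2 * r))" using w by (metis complex_norm_square)
      then have ww: "2 * of_real r * (w * cnj w) = of_real q" using r by simp
      have c: "c = 2 * z * cnj w * of_real r" using L(1) r by simp
      have "c * w = z * (2 * of_real r * (w * cnj w))" unfolding c by (simp only: mult_ac)
      then have "c * w = z * of_real q" unfolding ww .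
      then show ?thesis using w0 that by (simp add: field_simps)
    qed
    moreover have "w \<noteq> 0" if "q \<noteq> 0" using w that r by auto
    moreover have "w = 0" if "q = 0" using w that by auto
    ultimately show ?R using L by (auto simp: c_def field_simps)
  next
    assume R: ?R
    show ?L
    proof (cases "q = 0")
      case True
      then have "w = 0" "(cmod z)\<^sup>2 = 1" "c = 0" "vec_nth d 3 = r" using R cc by (auto simp: d3)
      then show ?thesis unfolding hopf_lift_iff s' unfolding s using r by simp
    next
      case False
      then have w0: "w \<noteq> 0" and zw: "z = w * c / of_real q" and sum: "(cmod z)\<^sup>2 + (cmod w)\<^sup>2 = 1"
        using R by (auto simp: c_def field_simps)
      have qp: "q > 0" using q False by simp
      have "(cmod z)\<^sup>2 = (cmod w)\<^sup>2 * ((r + vec_nth d 3) * q) / q\<^sup>2"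
        unfolding zw by (simp add: norm_mult norm_divide power_mult_distrib power_divide cc)
      also have "\<dots> = (cmod w)\<^sup>2 * (r + vec_nth d 3) / q" using qp by (simp add: power2_eq_square)
      finally have z2: "(cmod z)\<^sup>2 = (cmod w)\<^sup>2 * (2 * r - q) / q" by (simp add: d3)
      have w2: "(cmod w)\<^sup>2 = q / (2 * r)"
        using sum unfolding z2 using qp r by (simp add: field_simps)
      have ww: "w * cnj w = of_real (q / (2 * r))" using w2 by (metis complex_norm_square)
      have "2 * z * cnj w = 2 * c * (w * cnj w) / of_real q" unfolding zw by (simp add: mult_ac)
      also have "\<dots> = 2 * c * of_real (q / (2 * r)) / of_real q" unfolding ww ..
      also have "\<dots> = c / of_real r" using qp r by simp
      finally show ?thesis unfolding hopf_lift_iff s' unfolding s using sum w2 r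
        by (simp add: d3 field_simps)
    qed
  qed
qed

text \<open>The rule for \<open>z\<^sub>i\<^sub>j, w\<^sub>i\<^sub>j\<close> with \<open>i > j\<close> is the antipodal map lifted to \<open>\<complex>\<^sup>2\<close>, so these pairs are again
  lifts of the direction from point \<open>i\<close> to point \<open>j\<close>.\<close>

lemma hopf_lift_antipode:
  assumes "hopf_lift z w d"
  shows "hopf_lift (- cnj w) (cnj z) (- d)"
proof -
  have "Complex (- vec_nth d 1) (- vec_nth d 2) = - Complex (vec_nth d 1) (vec_nth d 2)"
    by (simp add: complex_eq_iff)
  then show ?thesis using assms unfolding hopf_lift_def by (auto simp: algebra_simps)
qed

lemma hopf_lift_squares:
  assumes "hopf_lift z w d"
  shows "2 * (z * cnj z) = 1 + of_real (vec_nth d 3)" "2 * (w * cnj w) = 1 - of_real (vec_nth d 3)"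
proof -
  have "2 * (z * cnj z) = (z * cnj z + w * cnj w) + (z * cnj z - w * cnj w)"
    "2 * (w * cnj w) = (z * cnj z + w * cnj w) - (z * cnj z - w * cnj w)" by simp_all
  then show "2 * (z * cnj z) = 1 + of_real (vec_nth d 3)" "2 * (w * cnj w) = 1 - of_real (vec_nth d 3)"
    using assms unfolding hopf_lift_def by simp_all
qed

text \<open>The fibres of the Hopf map are the orbits of the circle group. The phase is the Hermitian
  product of the two lifts.\<close>

lemma hopf_lift_phase:
  assumes "hopf_lift z w d" "hopf_lift z' w' d"
  shows "\<exists>k. cmod k = 1 \<and> z' = k * z \<and> w' = k * w"
proof -
  define k where "k = z' * cnj z + w' * cnj w"
  have "2 * z * cnj w = 2 * z' * cnj w'" using assms unfolding hopf_lift_def by metis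
  then have 1: "z * cnj w = z' * cnj w'" by (simp add: mult.assoc)
  have conj1: "cnj z * w = cnj z' * w'" using arg_cong[OF 1, of cnj] by simp
  have 2: "z * cnj z = z' * cnj z'" "w * cnj w = w' * cnj w'"
    using hopf_lift_squares[OF assms(1)] hopf_lift_squares[OF assms(2)]
    by (metis mult_left_cancel zero_neq_numeral)+
  have 3: "z * cnj z + w * cnj w = 1" using assms unfolding hopf_lift_def by simp
  have "k * z = z' * (z * cnj z) + w' * (z * cnj w)" by (simp add: k_def algebra_simps)
  also have "\<dots> = z' * (z * cnj z + w * cnj w)" unfolding 1 2(2) by (simp add: algebra_simps)
  finally have z: "z' = k * z" using 3 by simp
  have "k * w = w' * (w * cnj w) + z' * (cnj z * w)" by (simp add: k_def algebra_simps)
  also have "\<dots> = w' * (z * cnj z + w * cnj w)" unfolding conj1 2(1) by (simp add: algebra_simps)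
  finally have w: "w' = k * w" using 3 by simp
  have "k * cnj k = k * cnj k * (z * cnj z + w * cnj w)" using 3 by simp
  also have "\<dots> = z' * cnj z' + w' * cnj w'" unfolding z w by (simp add: algebra_simps)
  also have "\<dots> = 1" using assms unfolding hopf_lift_def by simp
  finally have "of_real ((cmod k)\<^sup>2) = (1 :: complex)" by (simp only: complex_norm_square)
  then have "(cmod k)\<^sup>2 = 1" by (simp only: of_real_eq_1_iff)
  then have "cmod k = 1" by (simp add: power2_eq_1_iff) (metis norm_not_less_zero less_minus_one_simps(1))
  with z w show ?thesis by blast
qed

lemma hopf_lift_exists:
  fixes d :: "real ^ 3"
  assumes "d \<noteq> 0"
  shows "\<exists>z w. hopf_lift z w (sgn d)"
proof -
  define q where "q = norm d - vec_nth d 3"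
  define c where "c = Complex (vec_nth d 1) (vec_nth d 2)"
  show ?thesis
  proof (cases "q = 0")
    case True
    then have "hopf_lift 1 0 (sgn d)" unfolding hopf_lift_sgn_iff[OF assms] by (simp add: q_def)
    then show ?thesis by blast
  next
    case False
    define p where "p = c / of_real q"
    define s where "s = sqrt ((cmod p)\<^sup>2 + 1)"
    have "(cmod p)\<^sup>2 + 1 > 0" by (simp add: add_nonneg_pos)
    then have s: "s > 0" "s\<^sup>2 = (cmod p)\<^sup>2 + 1" unfolding s_def by simp_all
    have "(cmod (p / of_real s))\<^sup>2 + (cmod (1 / of_real s))\<^sup>2 = ((cmod p)\<^sup>2 + 1) / s\<^sup>2"
      by (simp add: norm_divide power_divide add_divide_distrib)
    also have "\<dots> = 1" using s by (simp only: s(2)[symmetric]) simp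
    finally have "(cmod (p / of_real s))\<^sup>2 + (cmod (1 / of_real s))\<^sup>2 = 1" .
    moreover have "(p / of_real s) / (1 / of_real s) = p" using s by simp
    ultimately have "hopf_lift (p / of_real s) (1 / of_real s) (sgn d)"
      unfolding hopf_lift_sgn_iff[OF assms] using s(1) False unfolding p_def c_def q_def by simp
    then show ?thesis by blast
  qed
qed

lemma atiyah_choice_iff:
  assumes "inj_on x {1..n}"
  shows "atiyah_choice n x z w \<longleftrightarrow>
     (\<forall>i\<in>{1..n}. \<forall>j\<in>{1..n}. i < j \<longrightarrow> hopf_lift (z i j) (w i j) (sgn (x j - x i))) \<and>
     (\<forall>i\<in>{1..n}. \<forall>j\<in>{1..n}. j < i \<longrightarrow> z i j = - cnj (w j i) \<and> w i j = cnj (z j i))"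
proof -
  have "x j - x i \<noteq> 0" if "i \<in> {1..n}" "j \<in> {1..n}" "i < j" for i j
    using inj_onD[OF assms, of i j] that by auto
  then show ?thesis unfolding atiyah_choice_def Let_def by (auto simp: hopf_lift_sgn_iff)
qed

lemma atiyah_choice_hopf_lift:
  assumes "inj_on x {1..n}" "atiyah_choice n x z w" "i \<in> {1..n}" "j \<in> {1..n}" "i \<noteq> j"
  shows "hopf_lift (z i j) (w i j) (sgn (x j - x i))"
proof (cases "i < j")
  case True
  then show ?thesis using assms by (simp add: atiyah_choice_iff)
next
  case False
  then have "j < i" using assms by simp
  then have "hopf_lift (z j i) (w j i) (sgn (x i - x j))" "z i j = - cnj (w j i)" "w i j = cnj (z j i)"
    using assms by (auto simp: atiyah_choice_iff)
  moreover have "sgn (x j - x i) = - sgn (x i - x j)" using sgn_minus[of "x i - x j"] by simp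
  ultimately show ?thesis using hopf_lift_antipode[of "z j i" "w j i" "sgn (x i - x j)"] by simp
qed

lemma atiyah_choice_exists:
  assumes "inj_on x {1..n}"
  shows "\<exists>z w. atiyah_choice n x z w"
proof -
  have "\<exists>p. i \<in> {1..n} \<longrightarrow> j \<in> {1..n} \<longrightarrow> i < j \<longrightarrow> hopf_lift (fst p) (snd p) (sgn (x j - x i))" for i j
  proof (cases "i \<in> {1..n} \<and> j \<in> {1..n} \<and> i < j")
    case True
    then have "x j - x i \<noteq> 0" using inj_onD[OF assms, of i j] by auto
    from hopf_lift_exists[OF this] show ?thesis by auto
  qed auto
  then obtain p where p: "\<And>i j. i \<in> {1..n} \<Longrightarrow> j \<in> {1..n} \<Longrightarrow> i < j \<Longrightarrow> hopf_lift (fst (p i j)) (snd (p i j)) (sgn (x j - x i))"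
    by metis
  define z where "z i j = (if i < j then fst (p i j) else - cnj (snd (p j i)))" for i j
  define w where "w i j = (if i < j then snd (p i j) else cnj (fst (p j i)))" for i j
  have "atiyah_choice n x z w" unfolding atiyah_choice_iff[OF assms] z_def w_def using p by auto
  then show ?thesis by blast
qed

text \<open>The phases by which two choices differ at \<open>(i, j)\<close> and \<open>(j, i)\<close> are conjugate, so they cancel in
  the product over all ordered pairs.\<close>

lemma prod_off_diagonal_eq_1:
  fixes f :: "nat \<Rightarrow> nat \<Rightarrow> 'a :: comm_monoid_mult"
  assumes "finite S" "\<And>i j. i \<in> S \<Longrightarrow> j \<in> S \<Longrightarrow> j < i \<Longrightarrow> f i j * f j i = 1"
  shows "(\<Prod>i\<in>S. \<Prod>j\<in>S - {i}. f i j) = 1"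
proof -
  have "(\<Prod>j\<in>S - {i}. f i j) = (\<Prod>j\<in>{j\<in>S. j < i}. f i j) * (\<Prod>j\<in>{j\<in>S. i < j}. f i j)" for i
  proof -
    have "S - {i} = {j\<in>S. j < i} \<union> {j\<in>S. i < j}" by auto
    then show ?thesis using assms(1) by (simp add: prod.union_disjoint disjoint_iff)
  qed
  then have "(\<Prod>i\<in>S. \<Prod>j\<in>S - {i}. f i j)
    = (\<Prod>i\<in>S. \<Prod>j\<in>{j\<in>S. j < i}. f i j) * (\<Prod>i\<in>S. \<Prod>j\<in>{j\<in>S. i < j}. f i j)"
    by (simp add: prod.distrib)
  also have "(\<Prod>i\<in>S. \<Prod>j\<in>{j\<in>S. i < j}. f i j) = (\<Prod>i\<in>S. \<Prod>j\<in>{j\<in>S. j < i}. f j i)"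
    by (rule prod.swap_restrict[OF assms(1,1)])
  also have "(\<Prod>i\<in>S. \<Prod>j\<in>{j\<in>S. j < i}. f i j) * \<dots> = (\<Prod>i\<in>S. \<Prod>j\<in>{j\<in>S. j < i}. f i j * f j i)"
    by (simp add: prod.distrib)
  also have "\<dots> = 1" using assms(2) by (intro prod.neutral ballI) auto
  finally show ?thesis .
qed

lemma det_atiyah_mat_unique:
  assumes x: "inj_on x {1..n}" and zw: "atiyah_choice n x z w" "atiyah_choice n x z' w'"
  shows "Determinant.det (atiyah_mat n z' w') = Determinant.det (atiyah_mat n z w)"
proof -
  have "\<exists>k. i \<in> {1..n} \<longrightarrow> j \<in> {1..n} \<longrightarrow> i \<noteq> j \<longrightarrow> cmod k = 1 \<and> z' i j = k * z i j \<and> w' i j = k * w i j" for i j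
  proof (cases "i \<in> {1..n} \<and> j \<in> {1..n} \<and> i \<noteq> j")
    case True
    then show ?thesis
      using hopf_lift_phase[OF atiyah_choice_hopf_lift[OF x zw(1)] atiyah_choice_hopf_lift[OF x zw(2)], of i j] by auto
  qed auto
  then obtain k0 where k0: "\<And>i j. i \<in> {1..n} \<Longrightarrow> j \<in> {1..n} \<Longrightarrow> i \<noteq> j \<Longrightarrow>
     cmod (k0 i j) = 1 \<and> z' i j = k0 i j * z i j \<and> w' i j = k0 i j * w i j" by metis
  define k where "k i j = (if i < j then k0 i j else cnj (k0 j i))" for i j
  have k: "z' i j = k i j * z i j" "w' i j = k i j * w i j" if "i \<in> {1..n}" "j \<in> {1..n} - {i}" for i j
  proof -
    have "z' i j = k i j * z i j \<and> w' i j = k i j * w i j"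
    proof (cases "i < j")
      case True
      then show ?thesis using k0[of i j] that by (simp add: k_def)
    next
      case False
      then have "j < i" using that by simp
      then have "z i j = - cnj (w j i)" "w i j = cnj (z j i)" "z' i j = - cnj (w' j i)" "w' i j = cnj (z' j i)"
        using zw that unfolding atiyah_choice_iff[OF x] by auto
      then show ?thesis using k0[of j i] that False by (simp add: k_def)
    qed
    then show "z' i j = k i j * z i j" "w' i j = k i j * w i j" by auto
  qed
  have k_inv: "k i j * k j i = 1" if "i \<in> {1..n}" "j \<in> {1..n}" "j < i" for i j
    using k0[of j i] that complex_norm_square[of "k0 j i"] by (simp add: k_def mult.commute)
  define c where "c i = (\<Prod>j\<in>{1..n} - {i}. k i j)" for i
  have row: "row_poly n z' w' i = Polynomial.smult (c i) (row_poly n z w i)" if "i \<in> {1..n}" for i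
  proof -
    have "row_poly n z' w' i = (\<Prod>j\<in>{1..n} - {i}. Polynomial.smult (k i j) [:- w i j, z i j:])"
      unfolding row_poly_def using that by (intro prod.cong) (auto simp: k)
    then show ?thesis by (simp only: prod_smult c_def row_poly_def)
  qed
  have "atiyah_mat n z' w' = mat n n (\<lambda>(i, j). c (i + 1) * poly.coeff (row_poly n z w (i + 1)) j)"
    unfolding atiyah_mat_eq by (rule cong_mat) (auto simp: row)
  then have "Determinant.det (atiyah_mat n z' w') = (\<Prod>i<n. c (i + 1)) * Determinant.det (atiyah_mat n z w)"
    by (simp only: det_scale_rows atiyah_mat_eq)
  also have "(\<Prod>i<n. c (i + 1)) = (\<Prod>i\<in>{1..n}. c i)"
    by (rule prod.reindex_bij_witness[of _ "\<lambda>i. i - 1" "\<lambda>i. i + 1"]) auto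
  also have "\<dots> = 1" unfolding c_def by (rule prod_off_diagonal_eq_1) (use k_inv in auto)
  finally show ?thesis by simp
qed

lemma atiyah_det_eq:
  assumes x: "inj_on x {1..n}" and zw: "atiyah_choice n x z w"
  shows "atiyah_det n x = Determinant.det (atiyah_mat n z w)"
  unfolding atiyah_det_def atiyah_mat_def[symmetric]
  by (rule the_equality) (use zw det_atiyah_mat_unique[OF x zw] in blast)+
section \<open>Lifting a great circle\<close>

lemma hopf_lift_unit_phase:
  assumes "hopf_lift z w d" "k * cnj k = 1"
  shows "hopf_lift (k * z) (k * w) d"
proof -
  have e: "2 * (k * z) * cnj (k * w) = (k * cnj k) * (2 * z * cnj w)"
    "(k * z) * cnj (k * z) = (k * cnj k) * (z * cnj z)"
    "(k * w) * cnj (k * w) = (k * cnj k) * (w * cnj w)" by (simp_all add: mult_ac)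
  show ?thesis using assms(1) unfolding hopf_lift_def e assms(2) by simp
qed

text \<open>A unit vector of \<open>\<complex>\<^sup>2\<close> orthogonal to \<open>(a\<^sub>1, a\<^sub>2)\<close> is a phase times \<open>(cnj a\<^sub>2, - cnj a\<^sub>1)\<close>; hence it
  lifts the antipodal point.\<close>

lemma orthonormal_pair:
  fixes a1 a2 b1 b2 :: complex
  assumes a: "a1 * cnj a1 + a2 * cnj a2 = 1" and b: "b1 * cnj b1 + b2 * cnj b2 = 1"
    and ab: "b1 * cnj a1 + b2 * cnj a2 = 0"
  shows "b1 * cnj b1 = a2 * cnj a2" "b2 * cnj b2 = a1 * cnj a1" "b1 * cnj b2 = - (a1 * cnj a2)"
proof -
  define k where "k = b1 * a2 - b2 * a1"
  have ab1: "b1 * cnj a1 = - (b2 * cnj a2)" "b2 * cnj a2 = - (b1 * cnj a1)"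
    using ab by (simp_all add: add_eq_0_iff add.commute)
  have "b1 = b1 * (a1 * cnj a1 + a2 * cnj a2)" using a by simp
  also have "\<dots> = a1 * (b1 * cnj a1) + b1 * a2 * cnj a2" by (simp add: algebra_simps)
  also have "\<dots> = k * cnj a2" unfolding ab1(1) k_def by (simp add: algebra_simps)
  finally have b1: "b1 = k * cnj a2" .
  have "b2 = b2 * (a1 * cnj a1 + a2 * cnj a2)" using a by simp
  also have "\<dots> = b2 * a1 * cnj a1 + a2 * (b2 * cnj a2)" by (simp add: algebra_simps)
  also have "\<dots> = - k * cnj a1" unfolding ab1(2) k_def by (simp add: algebra_simps)
  finally have b2: "b2 = - k * cnj a1" .
  have "k * cnj k = k * cnj k * (a1 * cnj a1 + a2 * cnj a2)" using a by simp
  also have "\<dots> = b1 * cnj b1 + b2 * cnj b2" unfolding b1 b2 by (simp add: algebra_simps)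
  finally have kk: "k * cnj k = 1" using b by simp
  have "b1 * cnj b1 = (k * cnj k) * (a2 * cnj a2)" "b2 * cnj b2 = (k * cnj k) * (a1 * cnj a1)"
    "b1 * cnj b2 = - ((k * cnj k) * (a1 * cnj a2))"
    unfolding b1 b2 by (simp_all add: mult_ac)
  then show "b1 * cnj b1 = a2 * cnj a2" "b2 * cnj b2 = a1 * cnj a1" "b1 * cnj b2 = - (a1 * cnj a2)"
    unfolding kk by simp_all
qed

text \<open>The transition probability between two spin states: orthogonal directions have lifts whose
  Hermitian product has modulus \<open>1/\<surd>2\<close>.\<close>

lemma hopf_lift_inner:
  assumes "hopf_lift a1 a2 u" "hopf_lift s1 s2 v"
  shows "2 * ((s1 * cnj a1 + s2 * cnj a2) * cnj (s1 * cnj a1 + s2 * cnj a2)) = of_real (1 + inner u v)"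
proof -
  have A: "2 * a1 * cnj a2 = Complex (vec_nth u 1) (vec_nth u 2)" and S: "2 * s1 * cnj s2 = Complex (vec_nth v 1) (vec_nth v 2)"
    using assms unfolding hopf_lift_def by auto
  have A': "2 * cnj a1 * a2 = Complex (vec_nth u 1) (- vec_nth u 2)" and S': "2 * cnj s1 * s2 = Complex (vec_nth v 1) (- vec_nth v 2)"
    using arg_cong[OF A, of cnj] arg_cong[OF S, of cnj] by (simp_all add: complex_eq_iff)
  have "2 * (2 * ((s1 * cnj a1 + s2 * cnj a2) * cnj (s1 * cnj a1 + s2 * cnj a2)))
    = (2 * (s1 * cnj s1)) * (2 * (a1 * cnj a1)) + (2 * (s2 * cnj s2)) * (2 * (a2 * cnj a2))
    + (2 * s1 * cnj s2) * (2 * cnj a1 * a2) + (2 * cnj s1 * s2) * (2 * a1 * cnj a2)"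
    by (simp add: algebra_simps)
  also have "\<dots> = (1 + of_real (vec_nth v 3)) * (1 + of_real (vec_nth u 3)) + (1 - of_real (vec_nth v 3)) * (1 - of_real (vec_nth u 3))
    + Complex (vec_nth v 1) (vec_nth v 2) * Complex (vec_nth u 1) (- vec_nth u 2)
    + Complex (vec_nth v 1) (- vec_nth v 2) * Complex (vec_nth u 1) (vec_nth u 2)"
    unfolding hopf_lift_squares[OF assms(1)] hopf_lift_squares[OF assms(2)] A A' S S' by simp
  also have "\<dots> = 2 * of_real (1 + inner u v)"
    by (simp add: complex_eq_iff inner_vec_def sum_3 algebra_simps)
  finally show ?thesis by (rule mult_left_cancel[THEN iffD1, rotated]) simp
qed

text \<open>Half-angle parametrization of the lifts of a great circle. The vector \<open>(a\<^sub>1, a\<^sub>2)\<close> lifts \<open>u\<close>. A lift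
  \<open>(c\<^sub>1, c\<^sub>2)\<close> of \<open>v\<close> is given the phase that makes its product with \<open>(a\<^sub>1, a\<^sub>2)\<close> equal to the positive
  number \<open>1/\<surd>2\<close>; then \<open>b = \<surd>2 c - a\<close> is a unit vector orthogonal to \<open>a\<close>. The Hopf map is a
  Hermitian quadratic map that takes \<open>a\<close> to \<open>u\<close>, \<open>b\<close> to \<open>- u\<close> and \<open>(a + b)/\<surd>2\<close> to \<open>v\<close>,
  so its polarization at \<open>(a, b)\<close> is \<open>v\<close> and the double-angle formulas finish the proof.\<close>

lemma great_circle_lift:
  fixes u v :: "real ^ 3"
  assumes u: "norm u = 1" and v: "norm v = 1" and uv: "inner u v = 0"
  obtains a1 a2 b1 b2 :: complex where
    "a1 * cnj a1 + b1 * cnj b1 = 1" "a2 * cnj a2 + b2 * cnj b2 = 1" "cnj a1 * a2 + cnj b1 * b2 = 0"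
    "\<And>\<phi>. hopf_lift (of_real (cos (\<phi> / 2)) * a1 + of_real (sin (\<phi> / 2)) * b1)
            (of_real (cos (\<phi> / 2)) * a2 + of_real (sin (\<phi> / 2)) * b2) (cos \<phi> *\<^sub>R u + sin \<phi> *\<^sub>R v)"
proof -
  have nz: "u \<noteq> 0" "v \<noteq> 0" "sgn u = u" "sgn v = v" using u v by (auto simp: sgn_div_norm)
  obtain a1 a2 s1 s2 where a: "hopf_lift a1 a2 u" and s: "hopf_lift s1 s2 v"
    using hopf_lift_exists[OF nz(1)] hopf_lift_exists[OF nz(2)] unfolding nz(3,4) by blast
  define r :: complex where "r = of_real (sqrt 2)"
  have r: "r * r = 2" "cnj r = r" unfolding r_def by (simp_all flip: of_real_mult)
  define p where "p = s1 * cnj a1 + s2 * cnj a2"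
  have pp: "2 * (p * cnj p) = 1" using hopf_lift_inner[OF a s] uv by (simp add: p_def)
  \<comment> \<open>The phase for which the Hermitian product of the lifts becomes real and positive.\<close>
  define k where "k = r * cnj p"
  have kk: "k * cnj k = 1"
  proof -
    have "k * cnj k = (r * r) * (p * cnj p)" by (simp add: k_def r mult_ac)
    then show ?thesis using pp r by simp
  qed
  define c1 c2 where "c1 = k * s1" and "c2 = k * s2"
  have c: "hopf_lift c1 c2 v" unfolding c1_def c2_def by (rule hopf_lift_unit_phase[OF s kk])
  have ca: "r * (c1 * cnj a1 + c2 * cnj a2) = 1"
  proof -
    have "r * (c1 * cnj a1 + c2 * cnj a2) = (r * r) * (p * cnj p)"
      by (simp add: c1_def c2_def k_def p_def algebra_simps)
    then show ?thesis using pp r by simp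
  qed
  have ca': "r * (cnj c1 * a1 + cnj c2 * a2) = 1" using arg_cong[OF ca, of cnj] r(2) by simp
  define b1 b2 where "b1 = r * c1 - a1" and "b2 = r * c2 - a2"
  have aa: "a1 * cnj a1 + a2 * cnj a2 = 1" using a by (simp add: hopf_lift_def)
  have cc: "c1 * cnj c1 + c2 * cnj c2 = 1" using c by (simp add: hopf_lift_def)
  have ba: "b1 * cnj a1 + b2 * cnj a2 = 0"
  proof -
    have "b1 * cnj a1 + b2 * cnj a2 = r * (c1 * cnj a1 + c2 * cnj a2) - (a1 * cnj a1 + a2 * cnj a2)"
      by (simp add: b1_def b2_def algebra_simps)
    then show ?thesis unfolding ca aa by simp
  qed
  have bb: "b1 * cnj b1 + b2 * cnj b2 = 1"
  proof -
    have "b1 * cnj b1 + b2 * cnj b2 = (r * r) * (c1 * cnj c1 + c2 * cnj c2)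
      - r * (c1 * cnj a1 + c2 * cnj a2) - r * (cnj c1 * a1 + cnj c2 * a2) + (a1 * cnj a1 + a2 * cnj a2)"
      by (simp add: b1_def b2_def r(2) algebra_simps)
    then show ?thesis unfolding ca ca' cc aa r by simp
  qed
  note ortho = orthonormal_pair[OF aa bb ba]
  define U V where "U = Complex (vec_nth u 1) (vec_nth u 2)" and "V = Complex (vec_nth v 1) (vec_nth v 2)"
  have aU: "2 * (a1 * cnj a2) = U" and a3: "a1 * cnj a1 - a2 * cnj a2 = of_real (vec_nth u 3)"
    using a by (simp_all add: hopf_lift_def U_def mult.assoc)
  have cV: "2 * (c1 * cnj c2) = V" and c3: "c1 * cnj c1 - c2 * cnj c2 = of_real (vec_nth v 3)"
    using c by (simp_all add: hopf_lift_def V_def mult.assoc)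
  have rc: "r * c1 = a1 + b1" "r * c2 = a2 + b2" unfolding b1_def b2_def by simp_all
  have rr: "(r * x) * cnj (r * y) = 2 * (x * cnj y)" for x y
  proof -
    have "(r * x) * cnj (r * y) = (r * r) * (x * cnj y)" using r(2) by (simp add: mult_ac)
    then show ?thesis unfolding r(1) .
  qed
  have cross12: "a1 * cnj b2 + b1 * cnj a2 = V"
  proof -
    have "V = (r * c1) * cnj (r * c2)" unfolding rr cV ..
    also have "\<dots> = (a1 * cnj b2 + b1 * cnj a2) + a1 * cnj a2 + b1 * cnj b2"
      unfolding rc by (simp add: algebra_simps)
    finally show ?thesis unfolding ortho by simp
  qed
  have cross3: "a1 * cnj b1 + b1 * cnj a1 - a2 * cnj b2 - b2 * cnj a2 = 2 * of_real (vec_nth v 3)"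
  proof -
    have "2 * of_real (vec_nth v 3) = (r * c1) * cnj (r * c1) - (r * c2) * cnj (r * c2)"
      unfolding c3[symmetric] rr by (simp add: algebra_simps)
    also have "\<dots> = (a1 * cnj b1 + b1 * cnj a1 - a2 * cnj b2 - b2 * cnj a2)
        + (a1 * cnj a1 + b1 * cnj b1) - (a2 * cnj a2 + b2 * cnj b2)"
      unfolding rc by (simp add: algebra_simps)
    finally show ?thesis unfolding ortho by (simp add: add.commute)
  qed
  have cross0: "a1 * cnj b1 + b1 * cnj a1 + a2 * cnj b2 + b2 * cnj a2 = 0"
  proof -
    have "a1 * cnj b1 + b1 * cnj a1 + a2 * cnj b2 + b2 * cnj a2
      = (b1 * cnj a1 + b2 * cnj a2) + cnj (b1 * cnj a1 + b2 * cnj a2)"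
      by (simp add: algebra_simps)
    then show ?thesis unfolding ba by simp
  qed
  show thesis
  proof (rule that)
    show "a1 * cnj a1 + b1 * cnj b1 = 1" "a2 * cnj a2 + b2 * cnj b2 = 1"
      using aa unfolding ortho by (simp_all add: add.commute)
    have "cnj b1 * b2 = - (cnj a1 * a2)" using arg_cong[OF ortho(3), of cnj] by simp
    then show "cnj a1 * a2 + cnj b1 * b2 = 0" by simp
    fix \<phi> :: real
    define C S :: complex where "C = of_real (cos (\<phi> / 2))" and "S = of_real (sin (\<phi> / 2))"
    have CS: "cnj C = C" "cnj S = S" unfolding C_def S_def by simp_all
    have CS1: "C * C + S * S = 1"
      unfolding C_def S_def using sin_cos_squared_add2[of "\<phi> / 2"]
      by (simp add: power2_eq_square flip: of_real_mult of_real_add)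
    have cos: "of_real (cos \<phi>) = C * C - S * S" and sin: "of_real (sin \<phi>) = 2 * (C * S)"
      unfolding C_def S_def
      using arg_cong[OF cos_double[of "\<phi> / 2"], of complex_of_real]
        arg_cong[OF sin_double[of "\<phi> / 2"], of complex_of_real]
      by (simp_all add: power2_eq_square mult_ac)
    have 1: "2 * (C * a1 + S * b1) * cnj (C * a2 + S * b2)
      = Complex (vec_nth (cos \<phi> *\<^sub>R u + sin \<phi> *\<^sub>R v) 1) (vec_nth (cos \<phi> *\<^sub>R u + sin \<phi> *\<^sub>R v) 2)"
    proof -
      have "2 * (C * a1 + S * b1) * cnj (C * a2 + S * b2) =
        C * C * (2 * (a1 * cnj a2)) + S * S * (2 * (b1 * cnj b2)) + 2 * (C * S) * (a1 * cnj b2 + b1 * cnj a2)"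
        by (simp add: CS algebra_simps)
      also have "\<dots> = (C * C - S * S) * U + 2 * (C * S) * V"
        unfolding cross12 ortho using aU by (simp add: algebra_simps)
      also have "\<dots> = Complex (vec_nth (cos \<phi> *\<^sub>R u + sin \<phi> *\<^sub>R v) 1) (vec_nth (cos \<phi> *\<^sub>R u + sin \<phi> *\<^sub>R v) 2)"
        unfolding cos[symmetric] sin[symmetric] by (simp add: U_def V_def complex_eq_iff)
      finally show ?thesis .
    qed
    have 2: "(C * a1 + S * b1) * cnj (C * a1 + S * b1) + (C * a2 + S * b2) * cnj (C * a2 + S * b2) = 1"
    proof -
      have "(C * a1 + S * b1) * cnj (C * a1 + S * b1) + (C * a2 + S * b2) * cnj (C * a2 + S * b2)
        = C * C * (a1 * cnj a1 + a2 * cnj a2) + S * S * (b1 * cnj b1 + b2 * cnj b2)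
        + C * S * (a1 * cnj b1 + b1 * cnj a1 + a2 * cnj b2 + b2 * cnj a2)"
        by (simp add: CS algebra_simps)
      then show ?thesis unfolding aa bb cross0 using CS1 by simp
    qed
    have 3: "(C * a1 + S * b1) * cnj (C * a1 + S * b1) - (C * a2 + S * b2) * cnj (C * a2 + S * b2)
      = of_real (vec_nth (cos \<phi> *\<^sub>R u + sin \<phi> *\<^sub>R v) 3)"
    proof -
      have "(C * a1 + S * b1) * cnj (C * a1 + S * b1) - (C * a2 + S * b2) * cnj (C * a2 + S * b2)
        = C * C * (a1 * cnj a1 - a2 * cnj a2) + S * S * (b1 * cnj b1 - b2 * cnj b2)
        + C * S * (a1 * cnj b1 + b1 * cnj a1 - a2 * cnj b2 - b2 * cnj a2)"
        by (simp add: CS algebra_simps)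
      also have "\<dots> = (C * C - S * S) * of_real (vec_nth u 3) + 2 * (C * S) * of_real (vec_nth v 3)"
        unfolding cross3 ortho a3[symmetric] by (simp add: algebra_simps)
      finally show ?thesis unfolding cos[symmetric] sin[symmetric] by simp
    qed
    show "hopf_lift (of_real (cos (\<phi> / 2)) * a1 + of_real (sin (\<phi> / 2)) * b1)
            (of_real (cos (\<phi> / 2)) * a2 + of_real (sin (\<phi> / 2)) * b2) (cos \<phi> *\<^sub>R u + sin \<phi> *\<^sub>R v)"
      unfolding C_def[symmetric] S_def[symmetric] hopf_lift_def using 1 2 3 by blast
  qed
qed

section \<open>Trigonometric and q-binomial identities\<close>

lemma sin_diff_mult_sin_add: "sin (x - y) * sin (x + y) = (sin x)\<^sup>2 - (sin y)\<^sup>2" for x y :: real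
proof -
  have "sin (x - y) * sin (x + y) = (sin x)\<^sup>2 * (cos y)\<^sup>2 - (cos x)\<^sup>2 * (sin y)\<^sup>2"
    by (simp add: sin_diff sin_add algebra_simps power2_eq_square)
  then show ?thesis unfolding cos_squared_eq by (simp add: algebra_simps)
qed

lemma sin_pi_fraction_pos:
  assumes "0 < d" "d < n"
  shows "0 < sin (pi * d / n)"
proof (rule sin_gt_zero)
  have "0 < d / n" "d / n < 1" using assms by auto
  then have "0 < pi * (d / n)" "pi * (d / n) < pi * 1"
    by (intro mult_pos_pos mult_strict_left_mono; simp)+
  then show "0 < pi * d / n" "pi * d / n < pi" by simp_all
qed

lemma cmod_1_minus_cis: "cmod (1 - cis t) = 2 * \<bar>sin (t / 2)\<bar>"
  and cmod_1_plus_cis: "cmod (1 + cis t) = 2 * \<bar>cos (t / 2)\<bar>"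
proof -
  have "(cmod (1 - cis t))\<^sup>2 = 1 + ((cos t)\<^sup>2 + (sin t)\<^sup>2) - 2 * cos t"
    "(cmod (1 + cis t))\<^sup>2 = 1 + ((cos t)\<^sup>2 + (sin t)\<^sup>2) + 2 * cos t"
    by (simp_all only: cmod_power2) (simp_all add: power2_eq_square algebra_simps)
  then have "(cmod (1 - cis t))\<^sup>2 = (2 * \<bar>sin (t / 2)\<bar>)\<^sup>2" "(cmod (1 + cis t))\<^sup>2 = (2 * \<bar>cos (t / 2)\<bar>)\<^sup>2"
    using cos_double_sin[of "t / 2"] cos_double_cos[of "t / 2"] by (simp_all add: power_mult_distrib)
  then show "cmod (1 - cis t) = 2 * \<bar>sin (t / 2)\<bar>" "cmod (1 + cis t) = 2 * \<bar>cos (t / 2)\<bar>"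
    by (auto intro: power2_eq_imp_eq)
qed

text \<open>The product side of the finite q-binomial theorem with \<open>q = \<zeta>\<close>.\<close>

definition gauss_poly :: "complex \<Rightarrow> nat \<Rightarrow> complex poly" where
  "gauss_poly \<zeta> n = (\<Prod>s\<in>{1..<n}. [:1, \<zeta> ^ s:])"

text \<open>The product \<open>g(y) = \<Prod>\<^sub>s (1 + \<zeta>\<^sup>s y)\<close> satisfies \<open>(1 + \<zeta> y) g(\<zeta> y) = (1 + \<zeta>\<^sup>n y) g(y)\<close>, since both
  sides are the product over \<open>s = 1, \<dots>, n\<close>. At \<open>\<zeta>\<^sup>n = - 1\<close> the comparison of coefficients is a
  two-term recursion.\<close>

lemma gauss_poly_coeff_Suc:
  assumes "\<zeta> ^ n = - 1" "n \<ge> 1"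
  shows "(1 - \<zeta> ^ Suc m) * poly.coeff (gauss_poly \<zeta> n) (Suc m) = (1 + \<zeta> ^ Suc m) * poly.coeff (gauss_poly \<zeta> n) m"
proof -
  let ?g = "gauss_poly \<zeta> n"
  have "[:1, \<zeta>:] * pcompose ?g [:0, \<zeta>:] = [:1, \<zeta> ^ 1:] * (\<Prod>s\<in>{1..<n}. [:1, \<zeta> ^ Suc s:])"
    by (simp add: gauss_poly_def pcompose_prod pcompose_pCons mult.commute)
  also have "(\<Prod>s\<in>{1..<n}. [:1, \<zeta> ^ Suc s:]) = (\<Prod>s\<in>{Suc 1..<Suc n}. [:1, \<zeta> ^ s:])"
    by (rule prod.shift_bounds_Suc_ivl[symmetric])
  also have "[:1, \<zeta> ^ 1:] * \<dots> = (\<Prod>s\<in>{1..<Suc n}. [:1, \<zeta> ^ s:])"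
    using assms(2) by (intro prod.atLeast_Suc_lessThan[symmetric]) simp
  also have "\<dots> = ?g * [:1, - 1:]"
    using assms by (simp add: gauss_poly_def)
  finally have "poly.coeff ([:1, \<zeta>:] * pcompose ?g [:0, \<zeta>:]) (Suc m) = poly.coeff (?g * [:1, - 1:]) (Suc m)" by simp
  then show ?thesis
    by (simp add: coeff_pcompose_linear mult.commute[of ?g] algebra_simps)
qed

lemma gauss_poly_coeff:
  assumes "\<zeta> ^ n = - 1" "n \<ge> 1" "m < n" "\<And>j. 1 \<le> j \<Longrightarrow> j < n \<Longrightarrow> \<zeta> ^ j \<noteq> 1"
  shows "poly.coeff (gauss_poly \<zeta> n) m = (\<Prod>j=1..m. (1 + \<zeta> ^ j) / (1 - \<zeta> ^ j))"
  using assms(3)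
proof (induction m)
  case 0
  have "poly.coeff (gauss_poly \<zeta> n) 0 = poly (gauss_poly \<zeta> n) 0" by (simp add: poly_0_coeff_0)
  also have "\<dots> = 1" by (simp add: gauss_poly_def poly_prod)
  finally show ?case by simp
next
  case (Suc m)
  then have "1 - \<zeta> ^ Suc m \<noteq> 0" using assms(4)[of "Suc m"] by simp
  then have "poly.coeff (gauss_poly \<zeta> n) (Suc m) = (1 + \<zeta> ^ Suc m) / (1 - \<zeta> ^ Suc m) * poly.coeff (gauss_poly \<zeta> n) m"
    using gauss_poly_coeff_Suc[OF assms(1,2), of m] by (simp add: field_simps)
  then show ?case using Suc by (simp add: mult.commute)
qed

lemma prod_homogeneous:
  fixes A B :: "'a :: comm_ring_1"
  assumes "finite S"
  shows "(\<Prod>s\<in>S. A + c s * B) = (\<Sum>m\<le>card S. poly.coeff (\<Prod>s\<in>S. [:1, c s:]) m * B ^ m * A ^ (card S - m))"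
  using assms
proof (induction S rule: finite_induct)
  case (insert a S)
  let ?G = "\<Prod>s\<in>S. [:1, c s:]" and ?N = "card S"
  let ?f = "\<lambda>m. poly.coeff ?G m * B ^ m * A ^ (?N - m)"
  have top: "poly.coeff ?G (Suc ?N) = 0"
    using degree_prod_linear_le[OF insert.hyps(1), of "\<lambda>_. 1" c] by (intro coeff_eq_0) simp
  have "(\<Sum>m\<le>Suc ?N. poly.coeff ([:1, c a:] * ?G) m * B ^ m * A ^ (Suc ?N - m))
    = (\<Sum>m\<le>Suc ?N. poly.coeff ?G m * B ^ m * A ^ (Suc ?N - m))
    + (\<Sum>m\<le>Suc ?N. poly.coeff (pCons 0 (Polynomial.smult (c a) ?G)) m * B ^ m * A ^ (Suc ?N - m))"
    by (simp add: algebra_simps flip: sum.distrib)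
  also have "(\<Sum>m\<le>Suc ?N. poly.coeff ?G m * B ^ m * A ^ (Suc ?N - m)) = (\<Sum>m\<le>?N. A * ?f m)"
    unfolding sum.atMost_Suc top by (auto intro!: sum.cong simp: Suc_diff_le)
  also have "(\<Sum>m\<le>Suc ?N. poly.coeff (pCons 0 (Polynomial.smult (c a) ?G)) m * B ^ m * A ^ (Suc ?N - m)) = (\<Sum>m\<le>?N. c a * B * ?f m)"
    unfolding sum.atMost_Suc_shift by (auto intro!: sum.cong simp: mult_ac)
  also have "(\<Sum>m\<le>?N. A * ?f m) + (\<Sum>m\<le>?N. c a * B * ?f m) = (A + c a * B) * (\<Sum>m\<le>?N. ?f m)"
    by (simp add: sum_distrib_left distrib_right sum.distrib)
  finally show ?case using insert by simp
qed auto

section \<open>The determinant of a regular polygon\<close>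

text \<open>A chord is perpendicular to the bisector of the angle between its end points, which explains
  the angle \<open>\<pi>/2\<close> added to the mean \<open>\<pi>(a + b)/n\<close>. Measuring \<open>b\<close> by its cyclic distance \<open>s\<close> from \<open>a\<close> also
  accounts for the orientation: if \<open>b < a\<close> then \<open>a + s = b + n\<close>, and the additional half turn reverses
  the direction.\<close>

lemma regular_polygon_direction:
  fixes u v c :: "real ^ 3"
  assumes u: "norm u = 1" and v: "norm v = 1" and uv: "inner u v = 0" and r: "r > 0"
    and ab: "a < n" "b < n" "a \<noteq> b"
  defines "P \<equiv> \<lambda>k. c + r *\<^sub>R (cos (2 * pi * real k / real n) *\<^sub>R u + sin (2 * pi * real k / real n) *\<^sub>R v)"
    and "s \<equiv> if a < b then b - a else b + n - a"
  defines "\<phi> \<equiv> pi * (2 * real a + real s) / real n + pi / 2"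
  shows "sgn (P b - P a) = cos \<phi> *\<^sub>R u + sin \<phi> *\<^sub>R v"
proof -
  define e where "e = cos \<phi> *\<^sub>R u + sin \<phi> *\<^sub>R v"
  define x y where "x = pi * real a / real n" and "y = pi * real b / real n"
  have n: "real n > 0" using ab by simp
  have xy: "2 * pi * real a / real n = 2 * x" "2 * pi * real b / real n = 2 * y" by (simp_all add: x_def y_def)
  have "P b - P a = r *\<^sub>R ((cos (2 * y) - cos (2 * x)) *\<^sub>R u + (sin (2 * y) - sin (2 * x)) *\<^sub>R v)"
    unfolding P_def xy by (simp add: algebra_simps)
  also have "cos (2 * y) - cos (2 * x) = - (2 * sin (y - x) * sin (x + y))"
    using sin_diff_mult_sin_add[of y x] by (simp add: cos_double_sin add.commute)
  also have "sin (2 * y) - sin (2 * x) = 2 * sin (y - x) * cos (x + y)"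
    by (simp add: sin_diff_sin) (simp add: add_divide_distrib diff_divide_distrib add.commute)
  finally have PP: "P b - P a = (2 * r * sin (y - x)) *\<^sub>R (- sin (x + y) *\<^sub>R u + cos (x + y) *\<^sub>R v)"
    by (simp add: algebra_simps)
  have "\<exists>\<rho>>0. P b - P a = \<rho> *\<^sub>R e"
  proof (cases "a < b")
    case True
    then have "\<phi> = (x + y) + pi / 2" unfolding \<phi>_def s_def x_def y_def using n by (simp add: field_simps of_nat_diff)
    then have "e = - sin (x + y) *\<^sub>R u + cos (x + y) *\<^sub>R v" unfolding e_def by (simp add: cos_add sin_add)
    moreover have "sin (y - x) > 0"
      using sin_pi_fraction_pos[of "real b - real a" "real n"] True ab
      by (simp add: x_def y_def diff_divide_distrib right_diff_distrib)
    ultimately show ?thesis using PP r by (intro exI[of _ "2 * r * sin (y - x)"]) auto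
  next
    case False
    define q where "q = x + y"
    have "\<phi> = (q + pi / 2) + pi"
      unfolding \<phi>_def s_def q_def x_def y_def using n ab False by (simp add: field_simps of_nat_diff)
    then have "cos \<phi> = - cos (q + pi / 2)" "sin \<phi> = - sin (q + pi / 2)"
      by (simp_all only: cos_periodic_pi sin_periodic_pi)
    moreover have "cos (q + pi / 2) = - sin q" "sin (q + pi / 2) = cos q" by (simp_all add: cos_add sin_add)
    ultimately have e: "e = - (- sin (x + y) *\<^sub>R u + cos (x + y) *\<^sub>R v)" unfolding e_def q_def by simp
    have pos: "sin (x - y) > 0"
      using sin_pi_fraction_pos[of "real a - real b" "real n"] False ab
      by (simp add: x_def y_def diff_divide_distrib right_diff_distrib)
    have "sin (y - x) = - sin (x - y)" using sin_minus[of "x - y"] by simp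
    then have "P b - P a = (2 * r * sin (x - y)) *\<^sub>R e"
      unfolding PP e by (simp add: scaleR_diff_right)
    then show ?thesis using r pos by (intro exI[of _ "2 * r * sin (x - y)"]) auto
  qed
  then obtain \<rho> where "\<rho> > 0" "P b - P a = \<rho> *\<^sub>R e" by blast
  moreover have "norm e = 1"
  proof -
    have "(norm e)\<^sup>2 = (cos \<phi>)\<^sup>2 * (inner u u) + (sin \<phi>)\<^sup>2 * (inner v v) + 2 * cos \<phi> * sin \<phi> * (inner u v)"
      unfolding power2_norm_eq_inner e_def
      by (simp add: inner_add_left inner_add_right inner_commute[of v u] power2_eq_square algebra_simps)
    also have "\<dots> = 1" using u v uv by (simp add: norm_eq_1)
    finally show ?thesis by (simp add: power2_eq_1_iff) (metis norm_ge_zero not_one_le_zero one_neq_neg_one neg_0_le_iff_le zero_le_one le_minus_one_simps(3))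
  qed
  ultimately show ?thesis unfolding e_def[symmetric] by (simp add: sgn_div_norm)
qed

lemma dft_orthogonality:
  assumes "m < n" "m' < n"
  defines "\<omega> \<equiv> cis (2 * pi / real n)"
  shows "(\<Sum>a<n. cnj (\<omega> ^ (a * m)) * \<omega> ^ (a * m')) = (if m = m' then of_nat n else 0)"
proof -
  define r where "r = cis (2 * pi * (real m' - real m) / real n)"
  have n: "real n > 0" using assms by simp
  have "cnj (\<omega> ^ (a * m)) * \<omega> ^ (a * m') = r ^ a" for a
    unfolding \<omega>_def r_def using n by (simp add: Complex.DeMoivre cis_cnj cis_mult field_simps)
  then have sum: "(\<Sum>a<n. cnj (\<omega> ^ (a * m)) * \<omega> ^ (a * m')) = (\<Sum>a<n. r ^ a)" by simp
  show ?thesis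
  proof (cases "m = m'")
    case True
    then show ?thesis unfolding sum by (simp add: r_def)
  next
    case False
    have "r ^ n = cis (2 * pi * of_int (int m' - int m))" unfolding r_def using n by (simp add: Complex.DeMoivre)
    also have "\<dots> = 1" by (simp only: cis_multiple_2pi Ints_of_int)
    finally have rn: "r ^ n = 1" .
    have "sin (pi * (real m' - real m) / real n) \<noteq> 0"
    proof (cases "m < m'")
      case True
      then show ?thesis using sin_pi_fraction_pos[of "real m' - real m" "real n"] assms by simp
    next
      case F: False
      then have "0 < sin (pi * (real m - real m') / real n)"
        using sin_pi_fraction_pos[of "real m - real m'" "real n"] assms False by simp
      moreover have "pi * (real m' - real m) / real n = - (pi * (real m - real m') / real n)"
        by (simp add: right_diff_distrib diff_divide_distrib)
      ultimately show ?thesis by simp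
    qed
    then have "cmod (1 - r) \<noteq> 0" unfolding r_def cmod_1_minus_cis by simp
    then have "r \<noteq> 1" by auto
    then show ?thesis unfolding sum using geometric_sum[of r n] rn False by simp
  qed
qed

lemma det_mat_diagonal:
  "Determinant.det (mat n n (\<lambda>(i, j). if i = j then d i else 0)) = (\<Prod>i<n. d i)"
proof -
  have "Determinant.det (mat n n (\<lambda>(i, j). if i = j then d i else 0)) = prod_list (diag_mat (mat n n (\<lambda>(i, j). if i = j then d i else 0)))"
    by (rule det_upper_triangular[of _ n]) (auto simp: upper_triangular_def)
  then show ?thesis by (simp add: prod_list_diag_prod atLeast0LessThan)
qed
lemma bij_betw_cyclic_difference:
  fixes a n :: nat
  assumes "a < n"
  shows "bij_betw (\<lambda>b. if a < b then b - a else b + n - a) ({..<n} - {a}) {1..<n}"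
  by (rule bij_betw_byWitness[where f' = "\<lambda>s. if a + s < n then a + s else a + s - n"]) (use assms in auto)

lemma regular_polygon_indexing:
  assumes "regular_polygon_vertices n x"
  obtains u v :: "real ^ 3" and p :: "nat \<Rightarrow> nat" where
    "norm u = 1" "norm v = 1" "inner u v = 0" "inj_on x {1..n}" "bij_betw p {1..n} {..<n}"
    "\<And>i k. i \<in> {1..n} \<Longrightarrow> k \<in> {1..n} - {i} \<Longrightarrow> sgn (x k - x i) =
       (let s = if p i < p k then p k - p i else p k + n - p i;
            \<phi> = pi * (2 * real (p i) + real s) / real n + pi / 2
        in cos \<phi> *\<^sub>R u + sin \<phi> *\<^sub>R v)"
proof -
  obtain c u v :: "real ^ 3" and r where
    uv: "r > 0" "norm u = 1" "norm v = 1" "inner u v = 0" and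
    bij: "bij_betw x {1..n} ((\<lambda>k. c + r *\<^sub>R (cos (2 * pi * real k / real n) *\<^sub>R u
                        + sin (2 * pi * real k / real n) *\<^sub>R v)) ` {..<n})"
    using assms unfolding regular_polygon_vertices_def by blast
  define P where "P = (\<lambda>k. c + r *\<^sub>R (cos (2 * pi * real k / real n) *\<^sub>R u
                        + sin (2 * pi * real k / real n) *\<^sub>R v))"
  have x: "bij_betw x {1..n} (P ` {..<n})" using bij unfolding P_def .
  have "card (P ` {..<n}) = card {..<n}" using bij_betw_same_card[OF x] by simp
  then have P: "inj_on P {..<n}" by (intro eq_card_imp_inj_on) auto
  define p where "p = the_inv_into {..<n} P \<circ> x"
  have p: "bij_betw p {1..n} {..<n}" unfolding p_def
    by (rule bij_betw_trans[OF x bij_betw_the_inv_into]) (simp add: bij_betw_def P)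
  have Pp: "P (p i) = x i" if "i \<in> {1..n}" for i
    unfolding p_def comp_def using bij_betwE[OF x] that by (intro f_the_inv_into_f[OF P]) auto
  show thesis
  proof (rule that[OF uv(2,3,4) _ p])
    show "inj_on x {1..n}" using x by (rule bij_betw_imp_inj_on)
    fix i k assume ik: "i \<in> {1..n}" "k \<in> {1..n} - {i}"
    have "p i < n" "p k < n" using bij_betwE[OF p] ik by auto
    moreover have "p i \<noteq> p k" using inj_onD[OF bij_betw_imp_inj_on[OF p], of i k] ik by auto
    ultimately have "sgn (P (p k) - P (p i)) =
       (let s = if p i < p k then p k - p i else p k + n - p i;
            \<phi> = pi * (2 * real (p i) + real s) / real n + pi / 2
        in cos \<phi> *\<^sub>R u + sin \<phi> *\<^sub>R v)"
      unfolding Let_def P_def by (intro regular_polygon_direction uv)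
    then show "sgn (x k - x i) =
       (let s = if p i < p k then p k - p i else p k + n - p i;
            \<phi> = pi * (2 * real (p i) + real s) / real n + pi / 2
        in cos \<phi> *\<^sub>R u + sin \<phi> *\<^sub>R v)"
      using Pp ik by simp
  qed
qed

text \<open>Euler's formula for the half-angle combination of two linear forms: up to a phase, the angle only
  enters through \<open>cis \<phi>\<close>, which is what makes the rows of the matrix depend on the vertex in a simple
  way.\<close>

lemma linear_form_split:
  fixes X Y :: complex
  shows "of_real (cos (\<phi> / 2)) * X + of_real (sin (\<phi> / 2)) * Y =
     cis (- \<phi> / 2) / of_real (sqrt 2) *
       ((X + \<i> * Y) / of_real (sqrt 2) + cis \<phi> * ((X - \<i> * Y) / of_real (sqrt 2)))"
proof -
  define C S :: complex where "C = of_real (cos (\<phi> / 2))" and "S = of_real (sin (\<phi> / 2))"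
  have r: "of_real (sqrt 2) * of_real (sqrt 2) = (2 :: complex)" by (simp flip: of_real_mult)
  have m: "cis (- \<phi> / 2) = C - \<i> * S" and p: "cis (- \<phi> / 2) * cis \<phi> = C + \<i> * S"
    by (simp_all add: C_def S_def complex_eq_iff cis_mult)
  have "cis (- \<phi> / 2) / of_real (sqrt 2) *
       ((X + \<i> * Y) / of_real (sqrt 2) + cis \<phi> * ((X - \<i> * Y) / of_real (sqrt 2)))
    = (cis (- \<phi> / 2) * (X + \<i> * Y) + (cis (- \<phi> / 2) * cis \<phi>) * (X - \<i> * Y)) / (of_real (sqrt 2) * of_real (sqrt 2))"
    by (simp add: field_simps)
  also have "\<dots> = C * X + S * Y" unfolding p unfolding m r by (simp add: algebra_simps)
  finally show ?thesis by (simp add: C_def S_def)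
qed

text \<open>The binomial weights make the monomials of degree \<open>n - 1\<close> an orthogonal basis for an inner
  product invariant under unitary substitutions. Concretely, the weighted Gram matrix is the \<open>(n - 1)\<close>st power of
  the Hermitian product of the two points, and \<open>(A, B)\<close> preserves this product.\<close>

lemma cmod_det_unitary_forms:
  fixes A B :: "complex \<Rightarrow> complex" and \<tau> :: "nat \<Rightarrow> complex"
  assumes "n \<ge> 1" and unitary: "\<And>t t'. cnj (B t) * B t' + cnj (A t) * A t' = cnj t * t' + 1"
  shows "cmod (Determinant.det (mat n n (\<lambda>(m, l). B (\<tau> l) ^ m * A (\<tau> l) ^ (n - 1 - m))))
    = cmod (Determinant.det (mat n n (\<lambda>(m, l). \<tau> l ^ m)))"
proof (rule cmod_det_eq_of_gram[where C = "\<lambda>m. real ((n - 1) choose m)"])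
  fix k l
  have upto: "{..<n} = {..n - 1}" using assms(1) by auto
  have "(\<Sum>m<n. of_real (real ((n - 1) choose m)) * cnj (B (\<tau> k) ^ m * A (\<tau> k) ^ (n - 1 - m)) * (B (\<tau> l) ^ m * A (\<tau> l) ^ (n - 1 - m)))
    = (cnj (B (\<tau> k)) * B (\<tau> l) + cnj (A (\<tau> k)) * A (\<tau> l)) ^ (n - 1)"
    unfolding binomial_ring upto by (simp add: power_mult_distrib mult_ac)
  also have "\<dots> = (\<Sum>m<n. of_real (real ((n - 1) choose m)) * cnj (\<tau> k ^ m) * \<tau> l ^ m)"
    unfolding unitary unfolding binomial_ring upto by (simp add: power_mult_distrib mult_ac)
  finally show "(\<Sum>m<n. of_real (real ((n - 1) choose m)) * cnj (B (\<tau> k) ^ m * A (\<tau> k) ^ (n - 1 - m)) * (B (\<tau> l) ^ m * A (\<tau> l) ^ (n - 1 - m)))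
    = (\<Sum>m<n. of_real (real ((n - 1) choose m)) * cnj (\<tau> k ^ m) * \<tau> l ^ m)" .
qed auto

lemma cmod_det_dft:
  "cmod (Determinant.det (mat n n (\<lambda>(m, l). (cis (2 * pi / real n) ^ l) ^ m))) = sqrt (real n) ^ n"
proof -
  have "cmod (Determinant.det (mat n n (\<lambda>(m, l). (cis (2 * pi / real n) ^ l) ^ m)))
    = cmod (Determinant.det (mat n n (\<lambda>(i, j). if i = j then complex_of_real (sqrt (real n)) else 0)))"
  proof (rule cmod_det_eq_of_gram[where C = "\<lambda>_. 1"])
    fix k l assume kl: "k < n" "l < n"
    have "(\<Sum>m<n. of_real 1 * cnj ((cis (2 * pi / real n) ^ k) ^ m) * (cis (2 * pi / real n) ^ l) ^ m)
      = (if k = l then of_nat n else 0)"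
      using dft_orthogonality[OF kl] by (simp add: power_mult[symmetric] mult.commute)
    also have "\<dots> = (\<Sum>m<n. if m = k then (if k = l then of_nat n else 0) else 0)" using kl by simp
    also have "\<dots> = (\<Sum>m<n. of_real 1 * cnj (if m = k then complex_of_real (sqrt (real n)) else 0)
        * (if m = l then complex_of_real (sqrt (real n)) else 0))"
      by (intro sum.cong refl) (auto simp flip: of_real_mult)
    finally show "(\<Sum>m<n. of_real 1 * cnj ((cis (2 * pi / real n) ^ k) ^ m) * (cis (2 * pi / real n) ^ l) ^ m) = \<dots>" .
  qed simp
  then show ?thesis unfolding det_mat_diagonal by (simp add: norm_power)
qed

text \<open>The polynomials are evaluated at the \<open>n\<close>-th roots of unity. On the one hand this multiplies the
  coefficient matrix by the Fourier matrix \<open>F\<close>; on the other hand expanding in powers of \<open>A\<close> and \<open>B\<close>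
  factors the matrix of values as \<open>c Q\<close>, where \<open>|det Q| = |det F|\<close>. So the determinant has the modulus of
  \<open>det c\<close>, and \<open>c\<close> has orthogonal columns.\<close>

lemma cmod_atiyah_det_regular_polygon:
  assumes n: "n \<ge> 2" and poly: "regular_polygon_vertices n x"
  shows "cmod (atiyah_det n x) =
    (\<Prod>m<n. sqrt (real n) / sqrt 2 ^ (n - 1) * cmod (poly.coeff (gauss_poly (cis (pi / real n)) n) m))"
proof -
  define \<zeta> \<omega> where "\<zeta> = cis (pi / real n)" and "\<omega> = cis (2 * pi / real n)"
  define K where "K = 1 / sqrt 2 ^ (n - 1)"
  define g where "g = poly.coeff (gauss_poly \<zeta> n)"
  obtain u v p where uv: "norm u = 1" "norm v = 1" "inner u v = 0" and x: "inj_on x {1..n}"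
    and p: "bij_betw p {1..n} {..<n}"
    and dir: "\<And>i k. i \<in> {1..n} \<Longrightarrow> k \<in> {1..n} - {i} \<Longrightarrow> sgn (x k - x i) =
       (let s = if p i < p k then p k - p i else p k + n - p i;
            \<phi> = pi * (2 * real (p i) + real s) / real n + pi / 2
        in cos \<phi> *\<^sub>R u + sin \<phi> *\<^sub>R v)"
  proof (rule regular_polygon_indexing[OF poly], goal_cases)
    case (1 u v p)
    show ?case by (rule 1(1)[OF 1(2-7)])
  qed
  obtain a1 a2 b1 b2 where ab: "a1 * cnj a1 + b1 * cnj b1 = 1" "a2 * cnj a2 + b2 * cnj b2 = 1"
    "cnj a1 * a2 + cnj b1 * b2 = 0"
    and lift: "\<And>\<phi>. hopf_lift (of_real (cos (\<phi> / 2)) * a1 + of_real (sin (\<phi> / 2)) * b1)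
            (of_real (cos (\<phi> / 2)) * a2 + of_real (sin (\<phi> / 2)) * b2) (cos \<phi> *\<^sub>R u + sin \<phi> *\<^sub>R v)"
  proof (rule great_circle_lift[OF uv], goal_cases)
    case (1 a1 a2 b1 b2)
    show ?case by (rule 1(1)[OF 1(2-5)])
  qed
  define A B where "A t = ((a1 * t - a2) + \<i> * (b1 * t - b2)) / of_real (sqrt 2)"
    and "B t = ((a1 * t - a2) - \<i> * (b1 * t - b2)) / of_real (sqrt 2)" for t
  obtain z w where zw: "atiyah_choice n x z w" using atiyah_choice_exists[OF x] by blast
  have det: "atiyah_det n x = Determinant.det (atiyah_mat n z w)" by (rule atiyah_det_eq[OF x zw])

  have row: "\<exists>e. cmod e = 1 \<and> (\<forall>t. poly (row_poly n z w i) t =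
      e * of_real K * (\<Sum>m<n. g m * (\<i> * \<omega> ^ p i) ^ m * (B t ^ m * A t ^ (n - 1 - m))))"
    if i: "i \<in> {1..n}" for i
  proof -
    define s where "s k = (if p i < p k then p k - p i else p k + n - p i)" for k
    define \<phi> where "\<phi> k = pi * (2 * real (p i) + real (s k)) / real n + pi / 2" for k
    have "\<exists>c. cmod c = 1 \<and> (\<forall>t. z i k * t - w i k =
        c / of_real (sqrt 2) * (A t + cis (\<phi> k) * B t))" if k: "k \<in> {1..n} - {i}" for k
    proof -
      have "hopf_lift (z i k) (w i k) (cos (\<phi> k) *\<^sub>R u + sin (\<phi> k) *\<^sub>R v)"
        using atiyah_choice_hopf_lift[OF x zw, of i k] dir[OF i k] i k
        by (auto simp: Let_def s_def \<phi>_def)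
      from hopf_lift_phase[OF lift this] obtain c where c: "cmod c = 1"
        "z i k = c * (of_real (cos (\<phi> k / 2)) * a1 + of_real (sin (\<phi> k / 2)) * b1)"
        "w i k = c * (of_real (cos (\<phi> k / 2)) * a2 + of_real (sin (\<phi> k / 2)) * b2)" by blast
      have "z i k * t - w i k = (c * cis (- \<phi> k / 2)) / of_real (sqrt 2) * (A t + cis (\<phi> k) * B t)" for t
      proof -
        have "z i k * t - w i k = c * (of_real (cos (\<phi> k / 2)) * (a1 * t - a2) + of_real (sin (\<phi> k / 2)) * (b1 * t - b2))"
          unfolding c(2,3) by (simp add: algebra_simps)
        also have "\<dots> = (c * cis (- \<phi> k / 2)) / of_real (sqrt 2) * (A t + cis (\<phi> k) * B t)"
          unfolding linear_form_split A_def[symmetric] B_def[symmetric] by simp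
        finally show ?thesis .
      qed
      moreover have "cmod (c * cis (- \<phi> k / 2)) = 1" using c(1) by (simp add: norm_mult)
      ultimately show ?thesis by blast
    qed
    then have "\<exists>c. \<forall>k\<in>{1..n} - {i}. cmod (c k) = 1 \<and> (\<forall>t. z i k * t - w i k =
        c k / of_real (sqrt 2) * (A t + cis (\<phi> k) * B t))"
      by (intro bchoice ballI)
    then obtain c where c0: "\<forall>k\<in>{1..n} - {i}. cmod (c k) = 1 \<and> (\<forall>t. z i k * t - w i k =
        c k / of_real (sqrt 2) * (A t + cis (\<phi> k) * B t))" ..
    have c: "cmod (c k) = 1" "z i k * t - w i k = c k / of_real (sqrt 2) * (A t + cis (\<phi> k) * B t)"
      if "k \<in> {1..n} - {i}" for k t
      using bspec[OF c0 that] by auto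
    \<comment> \<open>As \<open>k\<close> runs through the other vertices, the cyclic distance runs once through \<open>1, \<dots>, n - 1\<close>, so
      the product does not depend on how the vertices are numbered.\<close>
    have bij_s: "bij_betw s ({1..n} - {i}) {1..<n}"
    proof -
      have "p i < n" using bij_betwE[OF p] i by auto
      have "bij_betw p ({1..n} - {i}) ({..<n} - {p i})"
        using bij_betw_DiffI[OF p, of "{i}" "{p i}"] i \<open>p i < n\<close> by (simp add: bij_betw_def)
      from bij_betw_trans[OF this bij_betw_cyclic_difference[OF \<open>p i < n\<close>]] show ?thesis
        by (simp add: comp_def s_def[abs_def])
    qed
    have cis_\<phi>: "cis (\<phi> k) = \<i> * \<omega> ^ p i * \<zeta> ^ s k" for k
    proof -
      have "\<phi> k = pi / 2 + real (p i) * (2 * pi / real n) + real (s k) * (pi / real n)"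
        using n by (simp add: \<phi>_def field_simps)
      then show ?thesis unfolding \<omega>_def \<zeta>_def Complex.DeMoivre by (simp flip: cis_mult)
    qed
    have "poly (row_poly n z w i) t = (\<Prod>k\<in>{1..n} - {i}. c k) * of_real K *
        (\<Sum>m<n. g m * (\<i> * \<omega> ^ p i) ^ m * (B t ^ m * A t ^ (n - 1 - m)))" for t
    proof -
      have "poly (row_poly n z w i) t = (\<Prod>k\<in>{1..n} - {i}. c k / of_real (sqrt 2) * (A t + cis (\<phi> k) * B t))"
        unfolding poly_row_poly by (intro prod.cong) (use c(2) in auto)
      also have "\<dots> = (\<Prod>k\<in>{1..n} - {i}. c k / of_real (sqrt 2)) * (\<Prod>k\<in>{1..n} - {i}. A t + cis (\<phi> k) * B t)"
        by (rule prod.distrib)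
      also have "(\<Prod>k\<in>{1..n} - {i}. c k / of_real (sqrt 2)) = (\<Prod>k\<in>{1..n} - {i}. c k) * of_real K"
        using i by (simp add: prod_dividef K_def)
      also have "(\<Prod>k\<in>{1..n} - {i}. A t + cis (\<phi> k) * B t) = (\<Prod>s\<in>{1..<n}. A t + \<zeta> ^ s * (\<i> * \<omega> ^ p i * B t))"
        unfolding cis_\<phi> using prod.reindex_bij_betw[OF bij_s, of "\<lambda>s. A t + \<zeta> ^ s * (\<i> * \<omega> ^ p i * B t)"]
        by (simp add: mult_ac)
      also have "\<dots> = (\<Sum>m\<le>n - 1. g m * (\<i> * \<omega> ^ p i * B t) ^ m * A t ^ (n - 1 - m))"
        using prod_homogeneous[of "{1..<n}" "A t" "\<lambda>s. \<zeta> ^ s" "\<i> * \<omega> ^ p i * B t"]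
        by (simp add: g_def gauss_poly_def)
      also have "{..n - 1} = {..<n}" using n by auto
      finally show ?thesis by (simp add: power_mult_distrib mult.assoc)
    qed
    moreover have "cmod (\<Prod>k\<in>{1..n} - {i}. c k) = 1" using c(1) by (simp add: prod_norm[symmetric])
    ultimately show ?thesis by blast
  qed
  have "\<exists>e. \<forall>i\<in>{1..n}. cmod (e i) = 1 \<and> (\<forall>t. poly (row_poly n z w i) t =
      e i * of_real K * (\<Sum>m<n. g m * (\<i> * \<omega> ^ p i) ^ m * (B t ^ m * A t ^ (n - 1 - m))))"
    by (intro bchoice ballI row)
  then obtain e where e0: "\<forall>i\<in>{1..n}. cmod (e i) = 1 \<and> (\<forall>t. poly (row_poly n z w i) t =
      e i * of_real K * (\<Sum>m<n. g m * (\<i> * \<omega> ^ p i) ^ m * (B t ^ m * A t ^ (n - 1 - m))))" ..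
  have e: "cmod (e i) = 1" "poly (row_poly n z w i) t =
      e i * of_real K * (\<Sum>m<n. g m * (\<i> * \<omega> ^ p i) ^ m * (B t ^ m * A t ^ (n - 1 - m)))"
    if "i \<in> {1..n}" for i t
    using bspec[OF e0 that] by auto

  define F where "F m l = (\<omega> ^ l) ^ m" for m l :: nat
  define Q where "Q m l = B (\<omega> ^ l) ^ m * A (\<omega> ^ l) ^ (n - 1 - m)" for m l
  define c where "c i m = e (i + 1) * of_real K * g m * (\<i> * \<omega> ^ p (i + 1)) ^ m" for i m
  define mF mQ mC where "mF = mat n n (\<lambda>(i, j). F i j)" and "mQ = mat n n (\<lambda>(i, j). Q i j)"
    and "mC = mat n n (\<lambda>(i, j). c i j)"

  \<comment> \<open>Both sides are the matrix of the values of the row polynomials at the roots of unity.\<close>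
  have "atiyah_mat n z w * mF = mC * mQ"
  proof (rule eq_matI)
    fix i l assume "i < dim_row (mC * mQ)" "l < dim_col (mC * mQ)"
    then have il: "i < n" "l < n" by (simp_all add: mC_def mQ_def)
    then have "(atiyah_mat n z w * mF) $$ (i, l) = (\<Sum>m<n. poly.coeff (row_poly n z w (i + 1)) m * (\<omega> ^ l) ^ m)"
      by (simp add: atiyah_mat_eq mF_def scalar_prod_def F_def atLeast0LessThan)
    also have "\<dots> = poly (row_poly n z w (i + 1)) (\<omega> ^ l)"
      using il by (intro poly_row_poly_sum[symmetric]) auto
    also have "\<dots> = (\<Sum>m<n. c i m * Q m l)"
      using il by (subst e(2)) (auto simp: sum_distrib_left c_def Q_def mult_ac)
    also have "\<dots> = (mC * mQ) $$ (i, l)"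
      using il by (simp add: mC_def mQ_def scalar_prod_def atLeast0LessThan)
    finally show "(atiyah_mat n z w * mF) $$ (i, l) = (mC * mQ) $$ (i, l)" .
  qed (simp_all add: atiyah_mat_def mF_def mC_def mQ_def)
  moreover have "atiyah_mat n z w \<in> carrier_mat n n" "mF \<in> carrier_mat n n" "mC \<in> carrier_mat n n" "mQ \<in> carrier_mat n n"
    by (simp_all add: atiyah_mat_def mF_def mC_def mQ_def)
  ultimately have "Determinant.det (atiyah_mat n z w) * Determinant.det mF = Determinant.det mC * Determinant.det mQ"
    by (simp flip: det_mult)
  from arg_cong[OF this, of cmod]
  have prod: "cmod (Determinant.det (atiyah_mat n z w)) * cmod (Determinant.det mF) = cmod (Determinant.det mC) * cmod (Determinant.det mQ)"
    by (simp only: norm_mult)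

  have unitary: "cnj (B t) * B t' + cnj (A t) * A t' = cnj t * t' + 1" for t t'
  proof -
    have r: "of_real (sqrt 2) * of_real (sqrt 2) = (2 :: complex)" by (simp flip: of_real_mult)
    have "cnj (B t) * B t' + cnj (A t) * A t' =
       (cnj (a1 * t - a2) * (a1 * t' - a2) + cnj (b1 * t - b2) * (b1 * t' - b2)) * 2 / (of_real (sqrt 2) * of_real (sqrt 2))"
      unfolding A_def B_def by (simp add: field_simps)
    also have "\<dots> = cnj (a1 * t - a2) * (a1 * t' - a2) + cnj (b1 * t - b2) * (b1 * t' - b2)"
      unfolding r by simp
    also have "\<dots> = (a1 * cnj a1 + b1 * cnj b1) * (cnj t * t') + (a2 * cnj a2 + b2 * cnj b2)
       - cnj t * (cnj a1 * a2 + cnj b1 * b2) - t' * cnj (cnj a1 * a2 + cnj b1 * b2)"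
      by (simp add: algebra_simps)
    also have "\<dots> = cnj t * t' + 1" unfolding ab by simp
    finally show ?thesis .
  qed
  have "cmod (Determinant.det mQ) = cmod (Determinant.det mF)"
    unfolding mQ_def mF_def Q_def F_def by (rule cmod_det_unitary_forms) (use n unitary in auto)
  moreover have "cmod (Determinant.det mF) \<noteq> 0"
    unfolding mF_def F_def \<omega>_def using n cmod_det_dft[of n] by simp
  ultimately have "cmod (atiyah_det n x) = cmod (Determinant.det mC)" using prod det by simp
  \<comment> \<open>The columns of \<open>c\<close> are multiples of columns of a Fourier matrix with permuted rows and phases.\<close>
  also have "\<dots> = cmod (Determinant.det (mat n n (\<lambda>(i, j). if i = j then complex_of_real (sqrt (real n) * K * cmod (g i)) else 0)))"
    unfolding mC_def
  proof (rule cmod_det_eq_of_gram[where C = "\<lambda>_. 1"])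
    fix k l assume kl: "k < n" "l < n"
    have "(\<Sum>i<n. of_real 1 * cnj (c i k) * c i l)
      = (\<Sum>i<n. (of_real (K * K) * (cnj (g k * \<i> ^ k) * (g l * \<i> ^ l))) * (cnj (\<omega> ^ (p (i + 1) * k)) * \<omega> ^ (p (i + 1) * l)))"
    proof (rule sum.cong[OF refl])
      fix i assume "i \<in> {..<n}"
      then have "cnj (e (i + 1)) * e (i + 1) = 1"
        using e(1)[of "i + 1"] complex_norm_square[of "e (i + 1)"] by (simp add: mult.commute)
      moreover have "of_real 1 * cnj (c i k) * c i l = (cnj (e (i + 1)) * e (i + 1)) *
        ((of_real (K * K) * (cnj (g k * \<i> ^ k) * (g l * \<i> ^ l))) * (cnj (\<omega> ^ (p (i + 1) * k)) * \<omega> ^ (p (i + 1) * l)))"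
        unfolding c_def by (simp add: power_mult_distrib mult_ac flip: power_mult)
      ultimately show "of_real 1 * cnj (c i k) * c i l =
        (of_real (K * K) * (cnj (g k * \<i> ^ k) * (g l * \<i> ^ l))) * (cnj (\<omega> ^ (p (i + 1) * k)) * \<omega> ^ (p (i + 1) * l))" by simp
    qed
    also have "\<dots> = (of_real (K * K) * (cnj (g k * \<i> ^ k) * (g l * \<i> ^ l))) * (\<Sum>i<n. cnj (\<omega> ^ (p (i + 1) * k)) * \<omega> ^ (p (i + 1) * l))"
      by (rule sum_distrib_left[symmetric])
    also have "(\<Sum>i<n. cnj (\<omega> ^ (p (i + 1) * k)) * \<omega> ^ (p (i + 1) * l)) = (\<Sum>i\<in>{1..n}. cnj (\<omega> ^ (p i * k)) * \<omega> ^ (p i * l))"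
      by (rule sum.reindex_bij_witness[of _ "\<lambda>i. i - 1" "\<lambda>i. i + 1"]) auto
    also have "\<dots> = (\<Sum>a<n. cnj (\<omega> ^ (a * k)) * \<omega> ^ (a * l))"
      by (rule sum.reindex_bij_betw[OF p])
    also have "\<dots> = (if k = l then of_nat n else 0)" unfolding \<omega>_def by (rule dft_orthogonality[OF kl])
    also have "(of_real (K * K) * (cnj (g k * \<i> ^ k) * (g l * \<i> ^ l))) * \<dots> =
      (if k = l then complex_of_real ((sqrt (real n) * K * cmod (g k)) * (sqrt (real n) * K * cmod (g k))) else 0)"
    proof (cases "k = l")
      case True
      have "cnj (g k * \<i> ^ k) * (g k * \<i> ^ k) = of_real ((cmod (g k))\<^sup>2)"
        using complex_norm_square[of "g k * \<i> ^ k"] by (simp add: norm_mult norm_power mult.commute)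
      moreover have "of_nat n = complex_of_real (sqrt (real n) * sqrt (real n))" by simp
      ultimately have "(of_real (K * K) * (cnj (g k * \<i> ^ k) * (g k * \<i> ^ k))) * of_nat n
        = complex_of_real (K * K) * of_real ((cmod (g k))\<^sup>2) * of_real (sqrt (real n) * sqrt (real n))"
        by (simp only:)
      also have "\<dots> = complex_of_real ((sqrt (real n) * K * cmod (g k)) * (sqrt (real n) * K * cmod (g k)))"
        unfolding of_real_mult[symmetric] by (simp only: power2_eq_square mult_ac)
      finally show ?thesis unfolding True[symmetric] by (simp only: refl if_True)
    qed simp
    also have "\<dots> = (\<Sum>m<n. if m = k then (if k = l then complex_of_real ((sqrt (real n) * K * cmod (g k)) * (sqrt (real n) * K * cmod (g k))) else 0) else 0)"
      using kl by simp
    also have "\<dots> = (\<Sum>m<n. of_real 1 * cnj (if m = k then complex_of_real (sqrt (real n) * K * cmod (g m)) else 0) * (if m = l then complex_of_real (sqrt (real n) * K * cmod (g m)) else 0))"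
      by (intro sum.cong refl) auto
    finally show "(\<Sum>i<n. of_real 1 * cnj (c i k) * c i l) = \<dots>" .
  qed simp
  also have "\<dots> = (\<Prod>m<n. sqrt (real n) * K * cmod (g m))"
    unfolding det_mat_diagonal prod_norm[symmetric]
    unfolding norm_of_real by (simp add: K_def)
  finally show ?thesis by (simp add: K_def g_def \<zeta>_def)
qed

section \<open>Primitives of the logarithm of the cotangent\<close>

lemma inverse_cubes_sums_zeta: "(\<lambda>k. 1 / real (Suc k) ^ 3) sums riemann_zeta 3"
proof -
  have "summable (\<lambda>k. inverse (real (Suc k) ^ 3))"
    using inverse_power_summable[of 3, where 'a = real] by (subst summable_Suc_iff) simp
  then have "summable (\<lambda>k. 1 / real (Suc k) ^ 3)" by (simp add: inverse_eq_divide)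
  moreover have "real (Suc k) powr 3 = real (Suc k) ^ 3" for k by (rule powr_numeral) simp
  then have "riemann_zeta 3 = (\<Sum>k. 1 / real (Suc k) ^ 3)"
    unfolding riemann_zeta_def by simp
  ultimately show ?thesis by (simp add: summable_sums)
qed

text \<open>The scaling of the argument puts the singularities of \<open>ln cot (\<pi>t/2)\<close> at \<open>0\<close> and \<open>1\<close> and its zero at
  \<open>1/2\<close>, so that the nodes of the Riemann sums are \<open>j/n\<close>. The difference of logarithms is the convenient
  form for differentiation and for the reflection \<open>t \<mapsto> 1 - t\<close>.\<close>

definition log_cot :: "real \<Rightarrow> real" where
  "log_cot t = ln (cos (pi * t / 2)) - ln (sin (pi * t / 2))"

lemma half_angle_pos:
  assumes "0 < t" "t < 1"
  shows "0 < sin (pi * t / 2)" "0 < cos (pi * t / 2)" "0 < sin (pi * t)"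
proof -
  have *: "0 < pi * t / 2" "pi * t / 2 < pi / 2" "0 < pi * t" "pi * t < pi" using assms by auto
  show "0 < sin (pi * t / 2)" using * by (intro sin_gt_zero) auto
  show "0 < cos (pi * t / 2)" using * by (intro cos_gt_zero) auto
  show "0 < sin (pi * t)" using * by (intro sin_gt_zero) auto
qed

lemma sin_pi_mult_double: "sin (pi * t) = 2 * sin (pi * t / 2) * cos (pi * t / (2::real))"
  using sin_double[of "pi * t / 2"] by simp

lemma log_cot_deriv:
  assumes "0 < t" "t < 1"
  shows "(log_cot has_real_derivative - pi / sin (pi * t)) (at t)"
proof -
  note pos = half_angle_pos[OF assms]
  have "(log_cot has_real_derivative
      - sin (pi * t / 2) * (pi / 2) / cos (pi * t / 2) - cos (pi * t / 2) * (pi / 2) / sin (pi * t / 2)) (at t)"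
    unfolding log_cot_def using pos by (auto intro!: derivative_eq_intros)
  also have "- sin (pi * t / 2) * (pi / 2) / cos (pi * t / 2) - cos (pi * t / 2) * (pi / 2) / sin (pi * t / 2)
      = - pi * ((sin (pi * t / 2))\<^sup>2 + (cos (pi * t / 2))\<^sup>2) / (2 * sin (pi * t / 2) * cos (pi * t / 2))"
  proof -
  have "- S * (pi / 2) / C - C * (pi / 2) / S = - pi * (S\<^sup>2 + C\<^sup>2) / (2 * S * C)"
    if "S \<noteq> 0" "C \<noteq> 0" for S C :: real
    using that by (simp add: divide_simps power2_eq_square) (simp add: algebra_simps)
  then show ?thesis using pos by simp
  qed
  also have "\<dots> = - pi / sin (pi * t)" unfolding sin_pi_mult_double by simp
  finally show ?thesis .
qed

lemma log_cot_reflect: "log_cot (1 - t) = - log_cot t"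
proof -
  have e: "pi * (1 - t) / 2 = pi / 2 - pi * t / 2" by (simp add: field_simps)
  show ?thesis unfolding log_cot_def e by (simp add: cos_diff sin_diff)
qed

lemma log_cot_half: "log_cot (1/2) = 0"
  using log_cot_reflect[of "1/2"] by simp

definition odd_cos_sum :: "nat \<Rightarrow> real \<Rightarrow> real" where
  "odd_cos_sum m t = (\<Sum>i<m. 2 * cos ((2 * real i + 1) * (pi * t)) / (2 * real i + 1))"

lemma sum_sin_odd: "sin x * (\<Sum>i<m. sin ((2 * real i + 1) * x)) = (sin (real m * x))\<^sup>2"
proof (induction m)
  case (Suc m)
  have e: "real (Suc m) * x + real m * x = (2 * real m + 1) * x" "real (Suc m) * x - real m * x = x"
    by (simp_all add: algebra_simps)
  have "sin x * sin ((2 * real m + 1) * x) = (sin (real (Suc m) * x))\<^sup>2 - (sin (real m * x))\<^sup>2"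
    using sin_diff_mult_sin_add[of "real (Suc m) * x" "real m * x"] unfolding e .
  then show ?case using Suc by (simp add: distrib_left)
qed auto

lemma odd_cos_sum_half: "odd_cos_sum m (1/2) = 0"
proof -
  have "cos ((2 * real i + 1) * (pi * (1/2))) = 0" for i
  proof -
    have "(2 * real i + 1) * (pi * (1/2)) = of_int (2 * int i + 1) * (pi / 2)" by simp
    then show ?thesis unfolding cos_zero_iff_int by (metis even_plus_one_iff even_mult_iff even_numeral)
  qed
  then show ?thesis by (simp add: odd_cos_sum_def)
qed

lemma DERIV_cos_mult_pi:
  assumes "k \<noteq> 0"
  shows "((\<lambda>t. c * cos (k * (pi * t)) / k) has_real_derivative - c * pi * sin (k * (pi * t))) (at t within A)"
  using assms by (auto intro!: derivative_eq_intros)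

lemma DERIV_sin_mult_pi:
  assumes "k \<noteq> 0"
  shows "((\<lambda>t. c * sin (k * (pi * t)) / k) has_real_derivative c * pi * cos (k * (pi * t))) (at t within A)"
  using assms by (auto intro!: derivative_eq_intros)

lemma odd_cos_sum_deriv:
  assumes "0 < t" "t < 1"
  shows "(odd_cos_sum m has_real_derivative - pi * (1 - cos (2 * real m * (pi * t))) / sin (pi * t)) (at t)"
proof -
  have "(odd_cos_sum m has_real_derivative (\<Sum>i<m. - 2 * pi * sin ((2 * real i + 1) * (pi * t)))) (at t)"
    unfolding odd_cos_sum_def
  proof (rule DERIV_sum)
    fix i
    have nz: "2 * real i + 1 \<noteq> 0" by linarith
    show "((\<lambda>t. 2 * cos ((2 * real i + 1) * (pi * t)) / (2 * real i + 1)) has_real_derivative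
       - 2 * pi * sin ((2 * real i + 1) * (pi * t))) (at t)"
      using DERIV_cos_mult_pi[OF nz, of 2] by simp
  qed
  also have "(\<Sum>i<m. - 2 * pi * sin ((2 * real i + 1) * (pi * t)))
     = - 2 * pi * (\<Sum>i<m. sin ((2 * real i + 1) * (pi * t)))" by (simp add: sum_distrib_left)
  also have "\<dots> = - 2 * pi * (sin (real m * (pi * t)))\<^sup>2 / sin (pi * t)"
    using half_angle_pos(3)[OF assms] sum_sin_odd[of "pi * t" m] by (simp add: field_simps)
  also have "\<dots> = - pi * (1 - cos (2 * real m * (pi * t))) / sin (pi * t)"
    using cos_double_sin[of "real m * (pi * t)"] by (simp add: mult.assoc)
  finally show ?thesis .
qed

text \<open>The Fourier series of \<open>log_cot\<close> converges locally uniformly on \<open>(0, 1)\<close>. The partial sum and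
  \<open>log_cot\<close> agree at \<open>1/2\<close>, and the derivative of their difference is the oscillating term
  \<open>\<pi> cos (2m\<pi>t) / sin (\<pi>t)\<close>. One integration by parts, carried out by subtracting
  \<open>sin (2m\<pi>t) / (2m sin (\<pi>t))\<close>, leaves a remainder with a derivative of size \<open>O(1/m)\<close>.\<close>

lemma odd_cos_sum_uniform_limit:
  assumes "0 < a" "a \<le> 1/2"
  shows "uniform_limit {a..1-a} odd_cos_sum log_cot sequentially"
proof -
  define s where "s = sin (pi * a)"
  have s: "s > 0" unfolding s_def using assms by (intro half_angle_pos) auto
  have sin_ge: "s \<le> sin (pi * t)" if "t \<in> {a..1-a}" for t
  proof (cases "t \<le> 1/2")
    case True
    have "0 < pi * a" using assms by simp
    with True show ?thesis unfolding s_def using that pi_gt_zero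
      by (intro sin_monotone_2pi_le) (auto simp del: pi_gt_zero)
  next
    case False
    have "0 < pi * a" using assms by simp
    have "pi * (1 - t) \<le> pi * (1/2)" using False by (intro mult_left_mono) auto
    with \<open>0 < pi * a\<close> have "s \<le> sin (pi * (1 - t))" unfolding s_def using that pi_gt_zero
      by (intro sin_monotone_2pi_le) (auto simp del: pi_gt_zero)
    also have "pi * (1 - t) = pi - pi * t" by (simp add: algebra_simps)
    finally show ?thesis by simp
  qed
  have bound: "\<bar>odd_cos_sum m t - log_cot t\<bar> \<le> (1 / s + pi / s\<^sup>2) / real m" if m: "m > 0" and t: "t \<in> {a..1-a}" for m t
  proof -
    define r where "r t = odd_cos_sum m t - log_cot t - sin (2 * real m * (pi * t)) / (2 * real m * sin (pi * t))" for t
    define r' where "r' t = sin (2 * real m * (pi * t)) / (2 * real m) * (pi * cos (pi * t)) / (sin (pi * t))\<^sup>2" for t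
    have r_deriv: "(r has_real_derivative r' x) (at x within {a..1-a})" if x: "x \<in> {a..1-a}" for x
    proof -
      have x01: "0 < x" "x < 1" using x assms by auto
      have sx: "sin (pi * x) > 0" using half_angle_pos(3)[OF x01] .
      have "((\<lambda>x. sin (2 * real m * (pi * x)) / (2 * real m * sin (pi * x))) has_real_derivative
          pi * cos (2 * real m * (pi * x)) / sin (pi * x) - r' x) (at x)"
        unfolding r'_def using sx m
        by (auto intro!: derivative_eq_intros simp: divide_simps power2_eq_square)
           (simp add: algebra_simps)
      from DERIV_diff[OF DERIV_diff[OF odd_cos_sum_deriv[OF x01, of m] log_cot_deriv[OF x01]] this]
      have "(r has_real_derivative - pi * (1 - cos (2 * real m * (pi * x))) / sin (pi * x) - - pi / sin (pi * x)
          - (pi * cos (2 * real m * (pi * x)) / sin (pi * x) - r' x)) (at x)" unfolding r_def .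
      also have "- pi * (1 - cos (2 * real m * (pi * x))) / sin (pi * x) - - pi / sin (pi * x)
          - (pi * cos (2 * real m * (pi * x)) / sin (pi * x) - r' x) = r' x"
        using sx by (simp add: field_simps)
      finally show ?thesis by (rule has_field_derivative_at_within)
    qed
    have r'_bound: "norm (r' x) \<le> pi / (2 * real m * s\<^sup>2)" if x: "x \<in> {a..1-a}" for x
    proof -
      have "\<bar>r' x\<bar> = \<bar>sin (2 * real m * (pi * x))\<bar> * \<bar>cos (pi * x)\<bar> * pi / (2 * real m * (sin (pi * x))\<^sup>2)"
        unfolding r'_def by (simp add: abs_mult)
      also have "\<dots> \<le> 1 * 1 * pi / (2 * real m * s\<^sup>2)"
        using m s sin_ge[OF x] by (intro frac_le mult_mono power_mono) auto
      finally show ?thesis by simp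
    qed
    have half: "1/2 \<in> {a..1-a}" using assms by auto
    have "r (1/2) = 0" unfolding r_def odd_cos_sum_half log_cot_half
      by simp
    then have "\<bar>r t\<bar> = norm (r t - r (1/2))" by simp
    also have "\<dots> \<le> pi / (2 * real m * s\<^sup>2) * norm (t - 1/2)"
      by (rule field_differentiable_bound[OF _ r_deriv r'_bound t half]) auto
    also have "\<dots> \<le> pi / (2 * real m * s\<^sup>2) * 1"
      using t assms by (intro mult_left_mono) (auto simp: abs_if)
    also have "\<dots> \<le> pi / (real m * s\<^sup>2)"
      using m s by (auto simp: field_simps)
    finally have 1: "\<bar>r t\<bar> \<le> pi / (real m * s\<^sup>2)" .
    have "\<bar>sin (2 * real m * (pi * t)) / (2 * real m * sin (pi * t))\<bar>
        = \<bar>sin (2 * real m * (pi * t))\<bar> / (2 * real m * sin (pi * t))"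
      using sin_ge[OF t] s m by (simp add: abs_mult)
    also have "\<dots> \<le> 1 / (real m * s)"
      using m s sin_ge[OF t] by (intro frac_le mult_mono) auto
    finally have 2: "\<bar>sin (2 * real m * (pi * t)) / (2 * real m * sin (pi * t))\<bar> \<le> 1 / (real m * s)" .
    have "\<bar>odd_cos_sum m t - log_cot t\<bar> \<le> pi / (real m * s\<^sup>2) + 1 / (real m * s)"
      using 1 2 unfolding r_def by linarith
    also have "\<dots> = (1 / s + pi / s\<^sup>2) / real m" using m s by (simp add: field_simps)
    finally show ?thesis .
  qed
  show ?thesis
  proof (rule uniform_limitI)
    fix e :: real assume "e > 0"
    have "(\<lambda>m. (1 / s + pi / s\<^sup>2) / real m) \<longlonglongrightarrow> 0" by real_asymp
    then have "\<forall>\<^sub>F m in sequentially. (1 / s + pi / s\<^sup>2) / real m < e"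
      using \<open>e > 0\<close> by (rule order_tendstoD)
    then show "\<forall>\<^sub>F m in sequentially. \<forall>t\<in>{a..1-a}. dist (odd_cos_sum m t) (log_cot t) < e"
      using eventually_gt_at_top[of 0]
    proof eventually_elim
      case (elim m)
      show ?case
      proof
        fix t assume "t \<in> {a..1-a}"
        from bound[OF elim(2) this] elim(1) show "dist (odd_cos_sum m t) (log_cot t) < e"
          unfolding dist_real_def by (rule le_less_trans)
      qed
    qed
  qed
qed

text \<open>The termwise first and second integrals of the Fourier series of \<open>log_cot\<close>. Unlike \<open>log_cot\<close>
  they are continuous on the whole line, so boundary values can be read off from the series.\<close>

definition log_cot_primitive :: "real \<Rightarrow> real" where
  "log_cot_primitive t = (\<Sum>i. 2 * sin ((2 * real i + 1) * (pi * t)) / ((2 * real i + 1)\<^sup>2 * pi))"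

definition log_cot_primitive2 :: "real \<Rightarrow> real" where
  "log_cot_primitive2 t = (\<Sum>i. - 2 * cos ((2 * real i + 1) * (pi * t)) / ((2 * real i + 1) ^ 3 * pi\<^sup>2))"

lemma summable_odd_power:
  assumes "k \<ge> 2"
  shows "summable (\<lambda>i. 1 / (2 * real i + 1) ^ k)"
proof (rule summable_comparison_test')
  have "summable (\<lambda>i. inverse (real (Suc i) ^ k))"
    using inverse_power_summable[of k, where 'a = real] assms by (subst summable_Suc_iff) simp
  then show "summable (\<lambda>i. 1 / real (Suc i) ^ k)" by (simp add: inverse_eq_divide)
  show "norm (1 / (2 * real i + 1) ^ k) \<le> 1 / real (Suc i) ^ k" for i
    using assms by (auto intro!: divide_left_mono power_mono)
qed

lemma log_cot_primitive_uniform_limit: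
  "uniform_limit UNIV (\<lambda>m t. \<Sum>i<m. 2 * sin ((2 * real i + 1) * (pi * t)) / ((2 * real i + 1)\<^sup>2 * pi)) log_cot_primitive sequentially"
  unfolding log_cot_primitive_def
proof (rule Weierstrass_m_test)
  show "summable (\<lambda>i. 1 / (2 * real i + 1)\<^sup>2)" by (rule summable_odd_power) simp
  show "norm (2 * sin ((2 * real i + 1) * (pi * t)) / ((2 * real i + 1)\<^sup>2 * pi)) \<le> 1 / (2 * real i + 1)\<^sup>2" for i t
  proof -
    have "norm (2 * sin ((2 * real i + 1) * (pi * t)) / ((2 * real i + 1)\<^sup>2 * pi))
      = 2 * \<bar>sin ((2 * real i + 1) * (pi * t))\<bar> / (pi * (2 * real i + 1)\<^sup>2)" by (simp add: abs_mult)
    also have "\<dots> \<le> pi * 1 / (pi * (2 * real i + 1)\<^sup>2)"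
      using pi_gt3 by (intro divide_right_mono mult_mono) auto
    finally show ?thesis by simp
  qed
qed

lemma isCont_log_cot_primitive: "isCont log_cot_primitive t"
proof -
  have "continuous_on UNIV log_cot_primitive"
    by (rule uniform_limit_theorem[OF _ log_cot_primitive_uniform_limit])
       (auto intro!: always_eventually continuous_intros)
  then show ?thesis by (simp add: continuous_on_eq_continuous_at)
qed

text \<open>Termwise differentiation is legitimate on every compact subinterval of \<open>(0, 1)\<close>, where the
  differentiated series converges uniformly.\<close>

lemma log_cot_primitive_deriv:
  assumes "0 < t" "t < 1"
  shows "(log_cot_primitive has_real_derivative log_cot t) (at t)"
proof -
  define a where "a = min t (1 - t) / 2"
  have a: "0 < a" "a \<le> 1/2" "t \<in> {a<..<1-a}" using assms by (auto simp: a_def min_def field_simps)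
  let ?f = "\<lambda>i t. 2 * sin ((2 * real i + 1) * (pi * t)) / ((2 * real i + 1)\<^sup>2 * pi)"
  have "\<exists>g. \<forall>x\<in>{a..1-a}. (\<lambda>i. ?f i x) sums g x \<and> (g has_real_derivative log_cot x) (at x within {a..1-a})"
  proof (rule has_field_derivative_series[where f' = "\<lambda>i t. 2 * cos ((2 * real i + 1) * (pi * t)) / (2 * real i + 1)"])
    show "(?f i has_real_derivative 2 * cos ((2 * real i + 1) * (pi * x)) / (2 * real i + 1)) (at x within {a..1-a})" for i x
    proof -
      have nz: "2 * real i + 1 \<noteq> 0" by linarith
      show ?thesis using DERIV_sin_mult_pi[OF nz, of "2 / ((2 * real i + 1) * pi)" x]
        by (simp add: power2_eq_square mult_ac)
    qed
    show "uniform_limit {a..1-a} (\<lambda>m x. \<Sum>i<m. 2 * cos ((2 * real i + 1) * (pi * x)) / (2 * real i + 1)) log_cot sequentially"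
      using odd_cos_sum_uniform_limit[OF a(1,2)] unfolding odd_cos_sum_def .
    show "t \<in> {a..1-a}" using a by auto
    show "summable (\<lambda>i. ?f i t)"
      using tendsto_uniform_limitI[OF log_cot_primitive_uniform_limit, of t] by (auto simp: summable_iff_convergent convergent_def)
  qed auto
  then obtain g where g: "\<And>x. x \<in> {a..1-a} \<Longrightarrow> (\<lambda>i. ?f i x) sums g x"
     "\<And>x. x \<in> {a..1-a} \<Longrightarrow> (g has_real_derivative log_cot x) (at x within {a..1-a})" by blast
  have eq: "g x = log_cot_primitive x" if "x \<in> {a..1-a}" for x
    using g(1)[OF that] unfolding log_cot_primitive_def by (simp add: sums_iff)
  have "(g has_real_derivative log_cot t) (at t)"
    using g(2)[of t] a at_within_interior[of t "{a..1-a}"] by (auto simp: interior_atLeastAtMost_real)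
  then show ?thesis
    by (rule has_field_derivative_transform_within_open[where S = "{a<..<1-a}"]) (use a eq in auto)
qed

lemma summable_log_cot_primitive2: "summable (\<lambda>i. - 2 * cos ((2 * real i + 1) * (pi * t)) / ((2 * real i + 1) ^ 3 * pi\<^sup>2))"
proof (rule summable_comparison_test')
  show "summable (\<lambda>i. 1 / (2 * real i + 1)^3)" by (rule summable_odd_power) simp
  show "norm (- 2 * cos ((2 * real i + 1) * (pi * t)) / ((2 * real i + 1)^3 * pi\<^sup>2)) \<le> 1 / (2 * real i + 1)^3" for i
  proof -
    have "2 \<le> pi\<^sup>2" using power_mono[of 2 pi 2] pi_gt3 by simp
    have "norm (- 2 * cos ((2 * real i + 1) * (pi * t)) / ((2 * real i + 1)^3 * pi\<^sup>2))
      = 2 * \<bar>cos ((2 * real i + 1) * (pi * t))\<bar> / (pi\<^sup>2 * (2 * real i + 1)^3)" by (simp add: abs_mult)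
    also have "\<dots> \<le> pi\<^sup>2 * 1 / (pi\<^sup>2 * (2 * real i + 1)^3)"
      using \<open>2 \<le> pi\<^sup>2\<close> by (intro divide_right_mono mult_mono) auto
    finally show ?thesis by simp
  qed
qed

lemma log_cot_primitive2_deriv: "(log_cot_primitive2 has_real_derivative log_cot_primitive t) (at t)"
proof -
  let ?f = "\<lambda>i t. - 2 * cos ((2 * real i + 1) * (pi * t)) / ((2 * real i + 1) ^ 3 * pi\<^sup>2)"
  have "\<exists>g. \<forall>x\<in>UNIV. (\<lambda>i. ?f i x) sums g x \<and> (g has_real_derivative log_cot_primitive x) (at x within UNIV)"
  proof (rule has_field_derivative_series[OF _ _ log_cot_primitive_uniform_limit])
    show "(?f i has_real_derivative 2 * sin ((2 * real i + 1) * (pi * x)) / ((2 * real i + 1)\<^sup>2 * pi)) (at x within UNIV)" for i x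
    proof -
      have nz: "2 * real i + 1 \<noteq> 0" by linarith
      show ?thesis using DERIV_cos_mult_pi[OF nz, of "- 2 / ((2 * real i + 1)\<^sup>2 * pi\<^sup>2)" x]
        by (simp add: power2_eq_square power3_eq_cube mult_ac)
    qed
    show "summable (\<lambda>i. ?f i 0)" by (rule summable_log_cot_primitive2)
  qed auto
  then obtain g where g: "\<And>x. (\<lambda>i. ?f i x) sums g x" "\<And>x. (g has_real_derivative log_cot_primitive x) (at x)" by auto
  have "g = log_cot_primitive2" using g(1) by (auto simp: log_cot_primitive2_def sums_iff)
  with g(2) show ?thesis by simp
qed

lemma odd_cubes_sums_zeta: "(\<lambda>i. 1 / (2 * real i + 1) ^ 3) sums (7 / 8 * riemann_zeta 3)"
proof -
  have "(\<lambda>i. sum (\<lambda>k. 1 / real (Suc k) ^ 3) {i*2..<i*2+2}) sums riemann_zeta 3"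
    using sums_group[OF inverse_cubes_sums_zeta, of 2] by simp
  moreover have "sum (\<lambda>k. 1 / real (Suc k) ^ 3) {i*2..<i*2+2}
      = 1 / (2 * real i + 1) ^ 3 + 1/8 * (1 / real (Suc i) ^ 3)" for i
  proof -
    have "{i*2..<i*2+2} = {2*i, 2*i+1}" by auto
    moreover have "real (Suc (2*i+1)) ^ 3 = 8 * real (Suc i) ^ 3"
      by (simp add: power3_eq_cube algebra_simps)
    ultimately show ?thesis by (simp add: add.commute)
  qed
  ultimately have "(\<lambda>i. 1 / (2 * real i + 1) ^ 3 + 1/8 * (1 / real (Suc i) ^ 3)) sums riemann_zeta 3"
    by simp
  from sums_diff[OF this sums_mult[OF inverse_cubes_sums_zeta, of "1/8"]]
  show ?thesis by simp
qed

lemma odd_mult_pi_reflect: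
  "sin ((2 * real i + 1) * (pi * (1 - t))) = sin ((2 * real i + 1) * (pi * t))"
  "cos ((2 * real i + 1) * (pi * (1 - t))) = - cos ((2 * real i + 1) * (pi * t))"
proof -
  have e: "(2 * real i + 1) * (pi * (1 - t)) = real (2 * i + 1) * pi - (2 * real i + 1) * (pi * t)"
    by (simp add: algebra_simps)
  have sc: "sin (real (2 * i + 1) * pi) = 0" "cos (real (2 * i + 1) * pi) = - 1"
    using sin_npi[of "2 * i + 1"] cos_npi[of "2 * i + 1"] by simp_all
  show "sin ((2 * real i + 1) * (pi * (1 - t))) = sin ((2 * real i + 1) * (pi * t))"
    "cos ((2 * real i + 1) * (pi * (1 - t))) = - cos ((2 * real i + 1) * (pi * t))"
    unfolding e sin_diff cos_diff sc by simp_all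
qed

lemma log_cot_primitive_reflect: "log_cot_primitive (1 - t) = log_cot_primitive t"
  unfolding log_cot_primitive_def odd_mult_pi_reflect ..

lemma log_cot_primitive2_reflect: "log_cot_primitive2 (1 - t) = - log_cot_primitive2 t"
  using suminf_minus[OF summable_log_cot_primitive2[of t]]
  unfolding log_cot_primitive2_def odd_mult_pi_reflect by simp

lemma log_cot_primitive2_0: "log_cot_primitive2 0 = - (7 / 4) * riemann_zeta 3 / pi\<^sup>2"
proof -
  have "(\<lambda>i. - 2 / pi\<^sup>2 * (1 / (2 * real i + 1) ^ 3)) sums (- 2 / pi\<^sup>2 * (7 / 8 * riemann_zeta 3))"
    by (intro sums_mult odd_cubes_sums_zeta)
  then show ?thesis by (simp add: log_cot_primitive2_def sums_iff mult_ac)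
qed

text \<open>The integrand of the limit in its symmetrized form, and the primitive obtained from it by
  integration by parts.\<close>

definition weighted_log_cot :: "real \<Rightarrow> real" where "weighted_log_cot t = (1 - 2 * t) * log_cot t"

definition weighted_primitive :: "real \<Rightarrow> real" where "weighted_primitive t = (1 - 2 * t) * log_cot_primitive t + 2 * log_cot_primitive2 t"

lemma weighted_primitive_deriv:
  assumes "0 < t" "t < 1"
  shows "(weighted_primitive has_real_derivative weighted_log_cot t) (at t)"
  unfolding weighted_primitive_def weighted_log_cot_def
  using assms by (auto intro!: derivative_eq_intros log_cot_primitive_deriv log_cot_primitive2_deriv)

lemma isCont_weighted_primitive: "isCont weighted_primitive t"
  unfolding weighted_primitive_def
  by (intro continuous_intros isCont_log_cot_primitive DERIV_isCont[OF log_cot_primitive2_deriv])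

lemma weighted_primitive_reflect: "weighted_primitive (1 - t) = - weighted_primitive t"
  unfolding weighted_primitive_def log_cot_primitive_reflect log_cot_primitive2_reflect by (simp add: algebra_simps)

lemma weighted_log_cot_reflect: "weighted_log_cot (1 - t) = weighted_log_cot t"
  unfolding weighted_log_cot_def log_cot_reflect by (simp add: algebra_simps)

lemma weighted_primitive_0: "weighted_primitive 0 = - (7 / 2) * riemann_zeta 3 / pi\<^sup>2"
  by (simp add: weighted_primitive_def log_cot_primitive2_0) (simp add: log_cot_primitive_def)

text \<open>The second derivative is the sum of \<open>4\<pi> / sin (\<pi>t)\<close> and a positive multiple of \<open>(1 - 2t) cos (\<pi>t)\<close>, whose two
  factors change sign together at \<open>1/2\<close>.\<close>

lemma weighted_log_cot_convex: "convex_on {0<..<1} weighted_log_cot"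
proof (rule f''_ge0_imp_convex)
  fix t :: real assume "t \<in> {0<..<1}"
  then have t: "0 < t" "t < 1" by auto
  note pos = half_angle_pos[OF t]
  show "(weighted_log_cot has_real_derivative - 2 * log_cot t - (1 - 2 * t) * pi / sin (pi * t)) (at t)"
    unfolding weighted_log_cot_def using t by (auto intro!: derivative_eq_intros log_cot_deriv)
  have "((\<lambda>t. (1 - 2 * t) * pi) has_real_derivative - 2 * pi) (at t)"
    "((\<lambda>t. sin (pi * t)) has_real_derivative pi * cos (pi * t)) (at t)"
    by (auto intro!: derivative_eq_intros)
  from DERIV_diff[OF DERIV_cmult[OF log_cot_deriv[OF t], of "- 2"] DERIV_divide[OF this]] pos
  have "((\<lambda>t. - 2 * log_cot t - (1 - 2 * t) * pi / sin (pi * t)) has_real_derivative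
      - 2 * (- pi / sin (pi * t)) - ((- 2 * pi) * sin (pi * t) - (1 - 2 * t) * pi * (pi * cos (pi * t)))
        / (sin (pi * t) * sin (pi * t))) (at t)" by simp
  also have "- 2 * (- pi / sin (pi * t)) - ((- 2 * pi) * sin (pi * t) - (1 - 2 * t) * pi * (pi * cos (pi * t)))
        / (sin (pi * t) * sin (pi * t))
      = 4 * pi / sin (pi * t) + (1 - 2 * t) * cos (pi * t) * pi\<^sup>2 / (sin (pi * t))\<^sup>2"
    using pos by (simp add: divide_simps power2_eq_square)
  finally show "((\<lambda>t. - 2 * log_cot t - (1 - 2 * t) * pi / sin (pi * t)) has_real_derivative
      4 * pi / sin (pi * t) + (1 - 2 * t) * cos (pi * t) * pi\<^sup>2 / (sin (pi * t))\<^sup>2) (at t)" .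
  have "0 \<le> (1 - 2 * t) * cos (pi * t)"
  proof (cases "t \<le> 1/2")
    case True
    then have "pi * t \<le> pi * (1/2)" by (intro mult_left_mono) auto
    then have "0 \<le> cos (pi * t)" using t by (intro cos_ge_zero) (auto intro: order_trans[of _ 0])
    then show ?thesis using True by simp
  next
    case False
    then have "pi * (1 - t) \<le> pi * (1/2)" by (intro mult_left_mono) auto
    then have "0 \<le> cos (pi * (1 - t))" using t by (intro cos_ge_zero) (auto intro: order_trans[of _ 0])
    also have "cos (pi * (1 - t)) = - cos (pi * t)" by (simp add: right_diff_distrib cos_diff)
    finally show ?thesis using False by (simp add: mult_nonpos_nonpos)
  qed
  then show "0 \<le> 4 * pi / sin (pi * t) + (1 - 2 * t) * cos (pi * t) * pi\<^sup>2 / (sin (pi * t))\<^sup>2"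
    using pos by simp
qed auto

section \<open>Riemann sums of a convex function\<close>

text \<open>The midpoint rule underestimates the integral of a convex function; the integral is expressed
  by a primitive.\<close>

lemma convex_midpoint_le_integral:
  fixes f F :: "real \<Rightarrow> real"
  assumes "convex_on {a<..<b} f" and F: "\<And>x. x \<in> {a<..<b} \<Longrightarrow> (F has_real_derivative f x) (at x)"
    and "0 \<le> d" "a < p - d" "p + d < b"
  shows "2 * d * f p \<le> F (p + d) - F (p - d)"
proof -
  define G where "G s = F (p + s) - F (p - s) - 2 * s * f p" for s
  have "G 0 \<le> G d"
  proof (rule DERIV_nonneg_imp_nondecreasing[OF \<open>0 \<le> d\<close>])
    fix s assume s: "0 \<le> s" "s \<le> d"
    have in_ab: "p + s \<in> {a<..<b}" "p - s \<in> {a<..<b}" using s assms by auto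
    have "((\<lambda>s. F (p + s)) has_real_derivative f (p + s) * 1) (at s)"
      by (rule DERIV_chain2[where f = F and g = "\<lambda>s. p + s", OF F[OF in_ab(1)]])
         (auto intro!: derivative_eq_intros)
    moreover have "((\<lambda>s. F (p - s)) has_real_derivative f (p - s) * (- 1)) (at s)"
      by (rule DERIV_chain2[where f = F and g = "\<lambda>s. p - s", OF F[OF in_ab(2)]])
         (auto intro!: derivative_eq_intros)
    ultimately have "(G has_real_derivative f (p + s) + f (p - s) - 2 * f p) (at s)"
      unfolding G_def by (auto intro!: derivative_eq_intros)
    moreover have "f ((1 - 1/2) *\<^sub>R (p + s) + (1/2) *\<^sub>R (p - s)) \<le> (1 - 1/2) * f (p + s) + 1/2 * f (p - s)"
      by (rule convex_onD[OF assms(1)]) (use in_ab in auto)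
    then have "0 \<le> f (p + s) + f (p - s) - 2 * f p" by (simp add: field_simps)
    ultimately show "\<exists>y. (G has_real_derivative y) (at s) \<and> 0 \<le> y" by blast
  qed
  then show ?thesis by (simp add: G_def)
qed

text \<open>The trapezoidal rule overestimates the integral of a convex function, because the chord lies above
  the graph.\<close>

lemma convex_integral_le_trapezoid:
  fixes f F :: "real \<Rightarrow> real"
  assumes "convex_on S f" and F: "\<And>x. x \<in> S \<Longrightarrow> (F has_real_derivative f x) (at x)"
    and "a < b" "{a..b} \<subseteq> S"
  shows "F b - F a \<le> (b - a) * (f a + f b) / 2"
proof -
  define m where "m = (f b - f a) / (b - a)"
  define G where "G x = f a * (x - a) + m * (x - a)\<^sup>2 / 2 - F x" for x
  have "G a \<le> G b"
  proof (rule DERIV_nonneg_imp_nondecreasing[where f = G])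
    show "a \<le> b" using assms by simp
  next
    fix x assume x: "a \<le> x" "x \<le> b"
    have "(G has_real_derivative f a + m * (x - a) - f x) (at x)"
      unfolding G_def using x assms(4) by (auto intro!: derivative_eq_intros F)
    moreover have "convex_on {a..b} f" using assms(1,4) by (rule convex_on_subset) simp
    from convex_onD_Icc'[OF this, of x] x have "f x \<le> m * (x - a) + f a" by (simp add: m_def)
    ultimately show "\<exists>y. (G has_real_derivative y) (at x) \<and> 0 \<le> y"
      by (intro exI[of _ "f a + m * (x - a) - f x"]) auto
  qed
  then have "F b - F a \<le> f a * (b - a) + m * (b - a)\<^sup>2 / 2" by (simp add: G_def)
  also have "m * (b - a)\<^sup>2 = (f b - f a) * (b - a)" using assms(3) by (simp add: m_def power2_eq_square)
  finally show ?thesis by (simp add: algebra_simps add_divide_distrib diff_divide_distrib)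
qed

lemma weighted_log_cot_nonneg:
  assumes "0 < t" "t \<le> 1/2"
  shows "0 \<le> weighted_log_cot t"
proof -
  have "pi * t \<le> pi * (1/2)" using assms by (intro mult_left_mono) auto
  moreover have "0 < pi * t" using assms by simp
  ultimately have "sin (pi * t / 2) \<le> sin (pi / 2 - pi * t / 2)"
    using pi_gt_zero by (intro sin_monotone_2pi_le) (auto simp del: pi_gt_zero)
  also have "\<dots> = cos (pi * t / 2)" by (simp add: sin_diff)
  finally have "0 \<le> log_cot t" using half_angle_pos[of t] assms unfolding log_cot_def by simp
  then show ?thesis using assms by (simp add: weighted_log_cot_def)
qed

lemma weighted_primitive_ge_at_0:
  assumes "0 \<le> t" "t \<le> 1/2"
  shows "weighted_primitive 0 \<le> weighted_primitive t"
proof (rule DERIV_nonneg_imp_increasing_open[OF assms(1)])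
  fix x assume "0 < x" "x < t"
  then show "\<exists>y. (weighted_primitive has_real_derivative y) (at x) \<and> 0 \<le> y"
    using weighted_primitive_deriv[of x] weighted_log_cot_nonneg[of x] assms by auto
qed (intro continuous_at_imp_continuous_on ballI isCont_weighted_primitive)

text \<open>Midpoint rule on the cells centred at \<open>j/n\<close>. They cover the unit interval up to half a cell at
  each end, where the integrand is nonnegative.\<close>

lemma riemann_sum_weighted_log_cot_le:
  assumes "n \<ge> 1"
  shows "(\<Sum>j=1..<n. weighted_log_cot (real j / real n)) \<le> real n * (- 2 * weighted_primitive 0)"
proof -
  have n: "real n > 0" using assms by simp
  define T where "T j = weighted_primitive ((2 * real j - 1) / (2 * real n))" for j
  have "weighted_log_cot (real j / real n) \<le> real n * (T (Suc j) - T j)" if "j \<in> {1..<n}" for j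
  proof -
    have "2 * (1 / (2 * real n)) * weighted_log_cot (real j / real n)
      \<le> weighted_primitive (real j / real n + 1 / (2 * real n)) - weighted_primitive (real j / real n - 1 / (2 * real n))"
      using that by (intro convex_midpoint_le_integral[OF weighted_log_cot_convex weighted_primitive_deriv]) (auto simp: field_simps)
    also have "real j / real n + 1 / (2 * real n) = (2 * real (Suc j) - 1) / (2 * real n)"
      using n by (simp add: field_simps)
    also have "real j / real n - 1 / (2 * real n) = (2 * real j - 1) / (2 * real n)"
      using n by (simp add: field_simps)
    finally show ?thesis using n by (simp add: T_def field_simps)
  qed
  then have "(\<Sum>j=1..<n. weighted_log_cot (real j / real n)) \<le> (\<Sum>j=1..<n. real n * (T (Suc j) - T j))" by (rule sum_mono)
  also have "\<dots> = real n * (T n - T 1)"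
    using assms by (simp only: sum_distrib_left[symmetric] sum_Suc_diff')
  also have "T n = weighted_primitive (1 - 1 / (2 * real n))" unfolding T_def using n by (simp add: field_simps)
  also have "\<dots> = - weighted_primitive (1 / (2 * real n))" by (rule weighted_primitive_reflect)
  also have "T 1 = weighted_primitive (1 / (2 * real n))" by (simp add: T_def)
  also have "real n * (- weighted_primitive (1 / (2 * real n)) - weighted_primitive (1 / (2 * real n))) \<le> real n * (- 2 * weighted_primitive 0)"
    using weighted_primitive_ge_at_0[of "1 / (2 * real n)"] n assms by (intro mult_left_mono) (auto simp: field_simps)
  finally show ?thesis .
qed

text \<open>Trapezoidal rule on the cells between consecutive nodes. The cells at the two ends, where the
  integrand is singular, are left out.\<close>

lemma riemann_sum_weighted_log_cot_ge:
  assumes "n \<ge> 2"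
  shows "(\<Sum>j=1..<n. weighted_log_cot (real j / real n)) \<ge> weighted_log_cot (1 / real n) - real n * (2 * weighted_primitive (1 / real n))"
proof -
  have n: "real n > 0" using assms by simp
  define T where "T j = weighted_primitive (real j / real n)" for j
  define e where "e j = weighted_log_cot (real j / real n) / 2" for j
  have "real n * (T (Suc j) - T j) \<le> e j + e (Suc j)" if "j \<in> {1..<n-1}" for j
  proof -
    have "weighted_primitive (real (Suc j) / real n) - weighted_primitive (real j / real n)
      \<le> (real (Suc j) / real n - real j / real n) * (weighted_log_cot (real j / real n) + weighted_log_cot (real (Suc j) / real n)) / 2"
    proof (rule convex_integral_le_trapezoid[OF weighted_log_cot_convex weighted_primitive_deriv])
      have "0 < real j / real n" "real (Suc j) / real n < 1" using that by (auto simp: field_simps)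
      then show "{real j / real n..real (Suc j) / real n} \<subseteq> {0<..<1}" by auto
    qed (use n in \<open>auto simp: field_simps\<close>)
    also have "real (Suc j) / real n - real j / real n = 1 / real n" by (simp add: diff_divide_distrib[symmetric])
    finally show ?thesis using n by (simp add: T_def e_def field_simps)
  qed
  then have "(\<Sum>j=1..<n-1. real n * (T (Suc j) - T j)) \<le> (\<Sum>j=1..<n-1. e j + e (Suc j))" by (rule sum_mono)
  also have "(\<Sum>j=1..<n-1. real n * (T (Suc j) - T j)) = real n * (T (n-1) - T 1)"
    using assms by (simp only: sum_distrib_left[symmetric]) (subst sum_Suc_diff', auto)
  also have "T (n - 1) = - T 1"
  proof -
    have "real (n - 1) / real n = 1 - 1 / real n" using assms by (simp add: field_simps of_nat_diff)
    then show ?thesis unfolding T_def by (simp add: weighted_primitive_reflect)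
  qed
  also have "(\<Sum>j=1..<n-1. e j + e (Suc j)) = 2 * (\<Sum>j=1..<n. e j) - e 1 - e (n - 1)"
  proof -
    have "(\<Sum>j=1..<n-1. e (Suc j)) = (\<Sum>j=Suc 1..<Suc (n-1). e j)" by (rule sum.shift_bounds_Suc_ivl[symmetric])
    also have "\<dots> = (\<Sum>j=1..<n. e j) - e 1"
      using assms sum.atLeast_Suc_lessThan[of 1 n e] by simp
    finally have 1: "(\<Sum>j=1..<n-1. e (Suc j)) = (\<Sum>j=1..<n. e j) - e 1" .
    have "(\<Sum>j=1..<Suc (n-1). e j) = (\<Sum>j=1..<n-1. e j) + e (n-1)"
      using assms by (intro sum.atLeastLessThan_Suc) auto
    then have 2: "(\<Sum>j=1..<n-1. e j) = (\<Sum>j=1..<n. e j) - e (n-1)" using assms by simp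
    show ?thesis unfolding sum.distrib 1 2 by simp
  qed
  also have "e (n - 1) = e 1"
  proof -
    have "real (n - 1) / real n = 1 - 1 / real n" using assms by (simp add: field_simps of_nat_diff)
    then show ?thesis unfolding e_def by (simp add: weighted_log_cot_reflect)
  qed
  also have "2 * (\<Sum>j=1..<n. e j) = (\<Sum>j=1..<n. weighted_log_cot (real j / real n))" by (simp add: e_def sum_distrib_left)
  finally show ?thesis by (simp add: T_def e_def)
qed

lemma sin_ge_mult_cos:
  assumes "0 \<le> x" "x \<le> pi"
  shows "x * cos x \<le> sin x"
proof -
  have "sin 0 - 0 * cos 0 \<le> sin x - x * cos x"
  proof (rule DERIV_nonneg_imp_nondecreasing[OF assms(1)])
    fix y assume y: "0 \<le> y" "y \<le> x"
    have "((\<lambda>x. sin x - x * cos x) has_real_derivative y * sin y) (at y)"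
      by (auto intro!: derivative_eq_intros)
    moreover have "0 \<le> y * sin y" using y assms by (intro mult_nonneg_nonneg sin_ge_zero) auto
    ultimately show "\<exists>d. ((\<lambda>x. sin x - x * cos x) has_real_derivative d) (at y) \<and> 0 \<le> d" by blast
  qed
  then show ?thesis by simp
qed

lemma log_cot_le:
  assumes "0 < t" "t < 1"
  shows "log_cot t \<le> ln (2 / (pi * t))"
proof -
  note pos = half_angle_pos[OF assms]
  have "pi * t / 2 * cos (pi * t / 2) \<le> sin (pi * t / 2)"
    using assms by (intro sin_ge_mult_cos) (auto intro: order_trans[of _ pi])
  then have "cos (pi * t / 2) / sin (pi * t / 2) \<le> 2 / (pi * t)"
    using pos assms by (simp add: field_simps)
  then have "ln (cos (pi * t / 2) / sin (pi * t / 2)) \<le> ln (2 / (pi * t))"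
    using pos by (intro ln_mono) auto
  then show ?thesis using pos unfolding log_cot_def by (simp add: ln_div)
qed

lemma log_cot_ge:
  assumes "0 < t" "t < 1"
  shows "log_cot t \<ge> ln (2 / (pi * t)) + ln (cos (pi * t / 2))"
proof -
  have "ln (sin (pi * t / 2)) \<le> ln (pi * t / 2)"
    using half_angle_pos[OF assms] assms by (intro ln_mono sin_x_le_x) auto
  moreover have "ln (2 / (pi * t)) = - ln (pi * t / 2)" using assms by (simp add: ln_div)
  ultimately show ?thesis unfolding log_cot_def by simp
qed

text \<open>The primitive of \<open>(1 - 2t) ln (2/(\<pi>t))\<close> that vanishes at \<open>0\<close>; the logarithm bounds \<open>log_cot\<close> and has
  the same singularity.\<close>

definition log_majorant_primitive :: "real \<Rightarrow> real" where
  "log_majorant_primitive t = (t - t\<^sup>2) * ln (2 / (pi * t)) + t - t\<^sup>2 / 2"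

text \<open>Bounds the part of the integral that the trapezoidal rule leaves out. The derivatives are
  compared on \<open>(0, t]\<close> only, and the comparison is extended to \<open>0\<close> by continuity.\<close>

lemma weighted_primitive_increment_le:
  assumes "0 < t" "t \<le> 1/2"
  shows "weighted_primitive t - weighted_primitive 0 \<le> log_majorant_primitive t"
proof -
  have mono: "weighted_primitive t - log_majorant_primitive t \<le> weighted_primitive s - log_majorant_primitive s" if "0 < s" "s \<le> t" for s
  proof (rule DERIV_nonpos_imp_nonincreasing[OF that(2)])
    fix x assume "s \<le> x" "x \<le> t"
    then have x: "0 < x" "x \<le> 1/2" "x < 1" using that assms by auto
    have "((\<lambda>t. weighted_primitive t - log_majorant_primitive t) has_real_derivative weighted_log_cot x - (1 - 2 * x) * ln (2 / (pi * x))) (at x)"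
      unfolding log_majorant_primitive_def using x
      by (auto intro!: derivative_eq_intros weighted_primitive_deriv simp: field_simps power2_eq_square)
    moreover have "weighted_log_cot x - (1 - 2 * x) * ln (2 / (pi * x)) \<le> 0"
      unfolding weighted_log_cot_def using log_cot_le[OF x(1,3)] x(2) by (simp add: mult_left_mono)
    ultimately show "\<exists>y. ((\<lambda>t. weighted_primitive t - log_majorant_primitive t) has_real_derivative y) (at x) \<and> y \<le> 0" by blast
  qed
  have "(log_majorant_primitive \<longlongrightarrow> 0) (at_right 0)" unfolding log_majorant_primitive_def by real_asymp
  moreover have "(weighted_primitive \<longlongrightarrow> weighted_primitive 0) (at_right 0)"
    using isCont_weighted_primitive[of 0] by (simp add: isCont_def filterlim_at_split)
  ultimately have "((\<lambda>s. weighted_primitive s - log_majorant_primitive s) \<longlongrightarrow> weighted_primitive 0 - 0) (at_right 0)" by (intro tendsto_diff)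
  moreover have "\<forall>\<^sub>F s in at_right 0. weighted_primitive t - log_majorant_primitive t \<le> weighted_primitive s - log_majorant_primitive s"
    using eventually_at_right_real[OF assms(1)] by eventually_elim (rule mono, auto)
  ultimately have "weighted_primitive t - log_majorant_primitive t \<le> weighted_primitive 0 - 0" by (intro tendsto_lowerbound) auto
  then show ?thesis by simp
qed

lemma ln_cos_ge:
  fixes x :: real
  assumes "x\<^sup>2 < 2"
  shows "ln (cos x) \<ge> - (x\<^sup>2 / (2 - x\<^sup>2))"
proof -
  have "cos x = 1 - 2 * (sin (x / 2))\<^sup>2" using cos_double_sin[of "x / 2"] by simp
  moreover have "(sin (x / 2))\<^sup>2 \<le> (x / 2)\<^sup>2" using abs_sin_x_le_abs_x[of "x / 2"] by (rule abs_le_square_iff[THEN iffD1])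
  ultimately have c: "1 - x\<^sup>2 / 2 \<le> cos x" by (simp add: power_divide)
  have pos: "0 < 1 - x\<^sup>2 / 2" using assms by simp
  have "ln (1 / (1 - x\<^sup>2 / 2)) \<le> 1 / (1 - x\<^sup>2 / 2) - 1" using pos by (intro ln_le_minus_one) simp
  also have "1 / (1 - x\<^sup>2 / 2) - 1 = x\<^sup>2 / (2 - x\<^sup>2)" using assms by (simp add: field_simps)
  finally have "- (x\<^sup>2 / (2 - x\<^sup>2)) \<le> ln (1 - x\<^sup>2 / 2)" using pos by (simp add: ln_div)
  also have "\<dots> \<le> ln (cos x)" using pos c by (intro ln_mono) auto
  finally show ?thesis .
qed

section \<open>Numerical bounds\<close>

text \<open>Both functions come from the expansion of \<open>1/k\<^sup>3\<close> into the reciprocals of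
  \<open>k (k\<^sup>2 - 1) \<cdots> (k\<^sup>2 - a\<^sup>2)\<close>, each of which telescopes. The remainder has the sign of the first
  omitted term, so two terms give a lower bound for the tail of the series and three terms an upper
  bound.\<close>

definition zeta_3_tail_below :: "real \<Rightarrow> real" where
  "zeta_3_tail_below k = 1 / (2 * k * (k-1)) - 1 / (4 * (k-2) * (k-1) * k * (k+1))"

definition zeta_3_tail_above :: "real \<Rightarrow> real" where
  "zeta_3_tail_above k = zeta_3_tail_below k + 2 / (3 * (k-3) * (k-2) * (k-1) * k * (k+1) * (k+2))"

lemma zeta_3_tail_below_step:
  assumes "(k::real) \<ge> 4"
  shows "1 / k ^ 3 - (zeta_3_tail_below k - zeta_3_tail_below (k+1)) = 4 / (k^3 * (k^2-1) * (k^2-4))"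
proof -
  have s: "k + 1 - 1 = k" "k+1-2 = k - 1" "k+1+1=k+2" by auto
  have n: "k \<noteq> 0" "k - 1 \<noteq> 0" "k - 2 \<noteq> 0" "k + 1 \<noteq> 0" "k + 2 \<noteq> 0"
    using assms by auto
  have e: "k^2-1 = (k-1)*(k+1)" "k^2-4 = (k-2)*(k+2)" by (auto simp: algebra_simps power2_eq_square)
  have n': "k^2-1 \<noteq> 0" "k^2-4 \<noteq> 0" unfolding e using n by auto
  have t1: "1 / (2 * k * (k-1)) - 1 / (2 * (k+1) * k) = 1 / (k * (k^2-1))"
    unfolding e using n by (simp add: divide_simps) (simp add: algebra_simps)
  have t2: "1 / (4 * (k-2) * (k-1) * k * (k+1)) - 1 / (4 * (k-1) * k * (k+1) * (k+2)) = 1 / (k * (k^2-1) * (k^2-4))"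
    unfolding e using n by (simp add: divide_simps) (simp add: algebra_simps)
  have "zeta_3_tail_below k - zeta_3_tail_below (k+1) = 1 / (k * (k^2-1)) - 1 / (k * (k^2-1) * (k^2-4))"
    unfolding t1[symmetric] t2[symmetric] by (simp add: zeta_3_tail_below_def s)
  also have "1 / k^3 - \<dots> = 4 / (k^3 * (k^2-1) * (k^2-4))"
    using n(1) n' by (simp add: divide_simps) (simp add: algebra_simps power2_eq_square power3_eq_cube)
  finally show ?thesis .
qed

lemma zeta_3_tail_above_step:
  assumes "(k::real) \<ge> 4"
  shows "(zeta_3_tail_above k - zeta_3_tail_above (k+1)) - 1 / k ^ 3 = 36 / (k^3 * (k^2-1) * (k^2-4) * (k^2-9))"
proof -
  have s: "k + 1 - 1 = k" "k+1-2 = k - 1" "k+1-3 = k-2" "k+1+1=k+2" "k+1+2=k+3" by auto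
  have n: "k \<noteq> 0" "k - 1 \<noteq> 0" "k - 2 \<noteq> 0" "k - 3 \<noteq> 0" "k + 1 \<noteq> 0" "k + 2 \<noteq> 0" "k + 3 \<noteq> 0"
    using assms by auto
  have e: "k^2-1 = (k-1)*(k+1)" "k^2-4 = (k-2)*(k+2)" "k^2-9 = (k-3)*(k+3)"
    by (auto simp: algebra_simps power2_eq_square)
  have n': "k^2-1 \<noteq> 0" "k^2-4 \<noteq> 0" "k^2-9 \<noteq> 0" unfolding e using n by auto
  define R where "R = (k-2) * (k-1) * k * (k+1) * (k+2)"
  have R: "R \<noteq> 0" "R = k * (k^2-1) * (k^2-4)" unfolding R_def e using n by auto
  have "2 / (3 * (k-3) * (k-2) * (k-1) * k * (k+1) * (k+2)) - 2 / (3 * (k-2) * (k-1) * k * (k+1) * (k+2) * (k+3))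
    = 2 / (3 * (k-3) * R) - 2 / (3 * R * (k+3))"
    by (simp add: R_def mult_ac)
  also have "\<dots> = 4 / (R * (k^2-9))"
    unfolding e using n R(1) by (simp add: divide_simps)
  finally have "zeta_3_tail_above k - zeta_3_tail_above (k+1) = (zeta_3_tail_below k - zeta_3_tail_below (k+1)) + 4 / (k * (k^2-1) * (k^2-4) * (k^2-9))"
    by (simp add: zeta_3_tail_above_def s R(2))
  moreover have "4 / (k * (k^2-1) * (k^2-4) * (k^2-9)) - 4 / (k^3 * (k^2-1) * (k^2-4))
      = 36 / (k^3 * (k^2-1) * (k^2-4) * (k^2-9))"
    using n(1) n' by (simp add: divide_simps) (simp add: algebra_simps power2_eq_square power3_eq_cube)
  ultimately show ?thesis using zeta_3_tail_below_step[OF assms] by simp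
qed

lemma telescoping_sums_zeta_tail:
  fixes T :: "real \<Rightarrow> real"
  assumes "(T \<longlongrightarrow> 0) at_top"
  shows "(\<lambda>k. T (real (k + m) + 1) - T (real (k + m) + 1 + 1)) sums T (real m + 1)"
proof -
  have f: "filterlim (\<lambda>k. real (k+m) + 1) at_top sequentially" by real_asymp
  have "(\<lambda>k. T (real (k+m) + 1)) \<longlonglongrightarrow> 0"
    using filterlim_compose[OF assms f] by simp
  from telescope_sums'[OF this] show ?thesis by (simp add: algebra_simps)
qed

text \<open>Twenty terms and the two tail bounds: the error of the upper bound is of order \<open>1/20\<^sup>8\<close>, that of
  the lower bound of order \<open>1/20\<^sup>6\<close>. The upper bound has to be sharper because the constant
  lies much closer to the upper of the two decimals that enclose it.\<close>

lemma zeta_3_bounds: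
  "riemann_zeta 3 \<in> {1.202056885 .. 1.2020569045}"
proof -
  define P where "P = (\<Sum>k<20. 1 / real (Suc k) ^ 3)"
  have tail: "(\<lambda>k. 1 / (real (k+20) + 1) ^ 3) sums (riemann_zeta 3 - P)"
    using sums_split_initial_segment[OF inverse_cubes_sums_zeta, of 20]
    by (simp add: P_def algebra_simps)
  have "((\<lambda>k. zeta_3_tail_below k) \<longlongrightarrow> 0) at_top" unfolding zeta_3_tail_below_def by real_asymp
  note l2 = telescoping_sums_zeta_tail[OF this, of 20]
  have "((\<lambda>k. zeta_3_tail_above k) \<longlongrightarrow> 0) at_top" unfolding zeta_3_tail_above_def zeta_3_tail_below_def by real_asymp
  note l3 = telescoping_sums_zeta_tail[OF this, of 20]
  have p: "k^2-1 > 0" "k^2-4 > 0" "k^2-9>0" "k > 0" if "k \<ge> 4" for k :: real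
    using that power_mono[of 4 k 2] by auto
  have "zeta_3_tail_below (real 20 + 1) \<le> riemann_zeta 3 - P"
  proof (rule sums_le[OF _ l2 tail])
    fix k have k: "real (k+20) + 1 \<ge> 4" by simp
    have "0 \<le> 4 / (K^3 * (K^2-1) * (K^2-4))" if "K \<ge> 4" for K :: real using p[OF that] by simp
    from this[OF k] zeta_3_tail_below_step[OF k]
    show "zeta_3_tail_below (real (k + 20) + 1) - zeta_3_tail_below (real (k + 20) + 1 + 1) \<le> 1 / (real (k + 20) + 1) ^ 3" by linarith
  qed
  moreover have "riemann_zeta 3 - P \<le> zeta_3_tail_above (real 20 + 1)"
  proof (rule sums_le[OF _ tail l3])
    fix k have k: "real (k+20) + 1 \<ge> 4" by simp
    have "0 \<le> 36 / (K^3 * (K^2-1) * (K^2-4) * (K^2-9))" if "K \<ge> 4" for K :: real using p[OF that] by simp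
    from this[OF k] zeta_3_tail_above_step[OF k]
    show "1 / (real (k + 20) + 1) ^ 3 \<le> zeta_3_tail_above (real (k + 20) + 1) - zeta_3_tail_above (real (k + 20) + 1 + 1)" by linarith
  qed
  moreover have "1.202056885 \<le> P + zeta_3_tail_below (real 20 + 1)"
    unfolding P_def zeta_3_tail_below_def by (simp add: lessThan_nat_numeral)
  moreover have "P + zeta_3_tail_above (real 20 + 1) \<le> 1.2020569045"
    unfolding P_def zeta_3_tail_above_def zeta_3_tail_below_def by (simp add: lessThan_nat_numeral)
  ultimately show ?thesis by auto
qed

lemma ln_2_bounds: "0.6931471804 \<le> ln (2::real)" "ln (2::real) \<le> 0.6931471809"
proof -
  have lower: "(\<Sum>k<9. 2*((2-1)/(2+1))^(2*k+1) / of_nat (2*k+1)) \<ge> (0.6931471804 :: real)"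
    by (simp add: lessThan_nat_numeral power_divide)
  have upper: "(\<Sum>k<9. 2*((2-1)/(2+1))^(2*k+1) / of_nat (2*k+1)) \<le> (0.6931471806 :: real)"
    by (simp add: lessThan_nat_numeral power_divide)
  have error: "2 * (((2-1)/(2+1))^(2*9+1) / (1 - ((2-1)/(2+1))^2) / of_nat (2*9+1)) \<le> (0.0000000002 :: real)"
    by (simp add: power_divide)
  have "(1::real) < 2" by simp
  note approx = ln_approx_bounds[OF this, of 9, unfolded atLeastAtMost_iff]
  show "0.6931471804 \<le> ln (2::real)" by (rule order_trans[OF lower conjunct1[OF approx]])
  have "ln (2::real) \<le> 0.6931471806 + 0.0000000002"
    by (rule order_trans[OF conjunct2[OF approx] add_mono[OF upper error]])
  then show "ln (2::real) \<le> 0.6931471809" by simp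
qed

lemma limit_value_bounds:
  defines "c \<equiv> 7 * riemann_zeta 3 / (2 * pi\<^sup>2) - ln 2 / 2"
  shows "0.07970480 \<le> c" and "c < 0.07970481"
proof -
  note z = zeta_3_bounds[unfolded atLeastAtMost_iff]
  have p: "9.86960440107 \<le> pi\<^sup>2" "pi\<^sup>2 \<le> 9.86960440111"
    using power_mono[OF pi_approx(1), of 2] power_mono[OF pi_approx(2), of 2]
    by (auto simp: power2_eq_square)
  have "7 * 1.202056885 / (2 * 9.86960440111) \<le> 7 * riemann_zeta 3 / (2 * pi\<^sup>2)"
    using z p by (intro frac_le mult_left_mono) auto
  then show "0.07970480 \<le> c" using ln_2_bounds unfolding c_def by simp
  have "7 * riemann_zeta 3 / (2 * pi\<^sup>2) \<le> 7 * 1.2020569045 / (2 * 9.86960440107)"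
    using z p by (intro frac_le mult_left_mono) auto
  then show "c < 0.07970481" using ln_2_bounds unfolding c_def by simp
qed
section \<open>Size of the determinant\<close>

lemma cmod_gauss_poly_coeff:
  assumes "m < n"
  shows "cmod (poly.coeff (gauss_poly (cis (pi / real n)) n) m) = exp (\<Sum>j=1..m. log_cot (real j / real n))"
proof -
  let ?\<zeta> = "cis (pi / real n)"
  have n: "real n > 0" using assms by simp
  have pow: "?\<zeta> ^ j = cis (pi * (real j / real n))" for j by (simp add: Complex.DeMoivre mult.commute)
  have pos: "0 < sin (pi * (real j / real n) / 2)" "0 < cos (pi * (real j / real n) / 2)" if "1 \<le> j" "j < n" for j
    using half_angle_pos[of "real j / real n"] that by auto
  have ne: "?\<zeta> ^ j \<noteq> 1" if "1 \<le> j" "j < n" for j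
    using cmod_1_minus_cis[of "pi * (real j / real n)"] pos[OF that] unfolding pow by auto
  have "?\<zeta> ^ n = -1" unfolding pow using n by simp
  then have "cmod (poly.coeff (gauss_poly ?\<zeta> n) m) = (\<Prod>j=1..m. cmod ((1 + ?\<zeta> ^ j) / (1 - ?\<zeta> ^ j)))"
    using gauss_poly_coeff[of ?\<zeta> n m] ne assms by (simp add: prod_norm)
  also have "\<dots> = (\<Prod>j=1..m. exp (log_cot (real j / real n)))"
  proof (rule prod.cong[OF refl])
    fix j assume "j \<in> {1..m}"
    then have "1 \<le> j" "j < n" using assms by auto
    then show "cmod ((1 + ?\<zeta> ^ j) / (1 - ?\<zeta> ^ j)) = exp (log_cot (real j / real n))"
      using pos[of j] unfolding pow norm_divide cmod_1_minus_cis cmod_1_plus_cis log_cot_def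
      by (simp add: exp_diff)
  qed
  also have "\<dots> = exp (\<Sum>j=1..m. log_cot (real j / real n))" by (simp add: exp_sum)
  finally show ?thesis .
qed

text \<open>The factor with index \<open>j\<close> occurs \<open>n - j\<close> times. Since \<open>log_cot\<close> is odd about \<open>1/2\<close>, averaging the sum with its
  reflection replaces the weight \<open>n - j\<close> by \<open>(n - 2j)/2\<close>.\<close>

lemma double_sum_log_cot:
  "(\<Sum>m<n. \<Sum>j=1..m. log_cot (real j / real n)) = real n / 2 * (\<Sum>j=1..<n. weighted_log_cot (real j / real n))"
proof (cases "n = 0")
  case False
  define L where "L j = log_cot (real j / real n)" for j
  have "(\<Sum>m<n. \<Sum>j=1..m. L j) = (\<Sum>m<n. \<Sum>j\<in>{j\<in>{1..<n}. j \<le> m}. L j)"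
    by (intro sum.cong) auto
  also have "\<dots> = (\<Sum>j\<in>{1..<n}. \<Sum>m\<in>{m\<in>{..<n}. j \<le> m}. L j)"
    by (rule sum.swap_restrict) auto
  also have "\<dots> = (\<Sum>j=1..<n. real (n - j) * L j)"
  proof (rule sum.cong[OF refl])
    fix j assume "j \<in> {1..<n}"
    have "{m\<in>{..<n}. j \<le> m} = {j..<n}" by auto
    then show "(\<Sum>m\<in>{m\<in>{..<n}. j \<le> m}. L j) = real (n - j) * L j" by simp
  qed
  finally have 1: "(\<Sum>m<n. \<Sum>j=1..m. L j) = (\<Sum>j=1..<n. real (n - j) * L j)" .
  also have "\<dots> = (\<Sum>j=1..<n. real j * L (n - j))"
    by (rule sum.reindex_bij_witness[of _ "\<lambda>j. n - j" "\<lambda>j. n - j"]) auto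
  also have "\<dots> = (\<Sum>j=1..<n. - real j * L j)"
  proof (rule sum.cong[OF refl])
    fix j assume "j \<in> {1..<n}"
    then have "real (n - j) / real n = 1 - real j / real n" by (simp add: of_nat_diff diff_divide_distrib)
    then show "real j * L (n - j) = - real j * L j" unfolding L_def by (simp add: log_cot_reflect)
  qed
  finally have "2 * (\<Sum>m<n. \<Sum>j=1..m. L j) = (\<Sum>j=1..<n. real (n - j) * L j + - real j * L j)"
    unfolding sum.distrib using 1 by simp
  also have "\<dots> = (\<Sum>j=1..<n. real n * weighted_log_cot (real j / real n))"
  proof (rule sum.cong[OF refl])
    fix j assume "j \<in> {1..<n}"
    then show "real (n - j) * L j + - real j * L j = real n * weighted_log_cot (real j / real n)"
      unfolding weighted_log_cot_def L_def by (simp add: of_nat_diff field_simps)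
  qed
  also have "\<dots> = real n * (\<Sum>j=1..<n. weighted_log_cot (real j / real n))" by (rule sum_distrib_left[symmetric])
  finally have "(\<Sum>m<n. \<Sum>j=1..m. L j) = real n * (\<Sum>j=1..<n. weighted_log_cot (real j / real n)) / 2" by linarith
  then show ?thesis unfolding L_def by simp
qed simp

text \<open>The value of \<open>ln D_n\<close>, in the form that contains the Riemann sum;
  \<open>cmod_atiyah_det_eq_exp\<close> makes the connection with the determinant.\<close>

definition log_polygon_det :: "nat \<Rightarrow> real" where
  "log_polygon_det n = real n / 2 * ln (real n) - real n * (real n - 1) / 2 * ln 2
     + real n / 2 * (\<Sum>j=1..<n. weighted_log_cot (real j / real n))"

lemma log_polygon_det_le:
  assumes "n \<ge> 1"
  shows "log_polygon_det n \<le> 7 * riemann_zeta 3 / (2 * pi\<^sup>2) * (real n)\<^sup>2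
     + real n / 2 * ln (real n) - real n * (real n - 1) / 2 * ln 2"
proof -
  have "real n / 2 * (\<Sum>j=1..<n. weighted_log_cot (real j / real n)) \<le> real n / 2 * (real n * (- 2 * weighted_primitive 0))"
    using riemann_sum_weighted_log_cot_le[OF assms] by (intro mult_left_mono) auto
  also have "\<dots> = 7 * riemann_zeta 3 / (2 * pi\<^sup>2) * (real n)\<^sup>2"
    by (simp add: weighted_primitive_0 power2_eq_square field_simps)
  finally show ?thesis unfolding log_polygon_det_def by simp
qed

text \<open>The terms of order \<open>n ln n\<close> cancel: the two omitted end cells contribute \<open>- n ln (2n/\<pi>)\<close>, the
  two boundary nodes give back half of it, and the factor \<open>n\<^bsup>n/2\<^esup>\<close> gives back the rest.\<close>

lemma log_polygon_det_ge:
  assumes n: "n \<ge> 5"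
  shows "log_polygon_det n \<ge> (7 * riemann_zeta 3 / (2 * pi\<^sup>2) - ln 2 / 2) * (real n)\<^sup>2
     - (1 - ln pi / 2) * real n + 1/2 - 0.65 / real n"
proof -
  define N where "N = real n"
  have N: "N \<ge> 5" using n by (simp add: N_def)
  define l where "l = ln (2 * N / pi)"
  define c where "c = 7 * riemann_zeta 3 / (2 * pi\<^sup>2)"
  have ln_N: "ln N = l + ln pi - ln 2" unfolding l_def using N by (simp add: ln_div ln_mult)
  have l2: "ln (2 / (pi * (1 / N))) = l" unfolding l_def using N by (simp add: field_simps)
  have Q_eq: "log_majorant_primitive (1 / N) = (1 / N - 1 / N\<^sup>2) * l + 1 / N - 1 / (2 * N\<^sup>2)"
    unfolding log_majorant_primitive_def l2 by (simp add: power_divide)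
  have h_ge: "weighted_log_cot (1 / N) \<ge> (1 - 2 / N) * l - 1.3 / N\<^sup>2"
  proof -
    define x where "x = pi * (1 / N) / 2"
    have x: "x\<^sup>2 = (pi\<^sup>2 / 4) / N\<^sup>2" by (simp add: x_def power_divide power_mult_distrib)
    have pi2: "pi\<^sup>2 \<le> 9.87" using power_mono[OF pi_approx(2), of 2] by (simp add: power2_eq_square)
    have N2: "N\<^sup>2 \<ge> 25" using power_mono[OF N, of 2] by simp
    have x2: "x\<^sup>2 \<le> 2.4675 / N\<^sup>2"
      unfolding x using pi2 by (intro divide_right_mono) auto
    also have "\<dots> \<le> 2.4675 / 25" using N2 by (intro divide_left_mono) auto
    finally have x2': "x\<^sup>2 \<le> 0.0987" by simp
    have "x\<^sup>2 / (2 - x\<^sup>2) \<le> (2.4675 / N\<^sup>2) / 1.9" using x2 x2' by (intro frac_le) auto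
    also have "\<dots> = (2.4675 / 1.9) / N\<^sup>2" by simp
    also have "\<dots> \<le> 1.3 / N\<^sup>2" by (intro divide_right_mono) auto
    finally have e: "- (1.3 / N\<^sup>2) \<le> ln (cos x)" using ln_cos_ge[of x] x2' by simp
    have "l - 1.3 / N\<^sup>2 \<le> log_cot (1 / N)"
      using log_cot_ge[of "1 / N"] N e unfolding l2 x_def by simp
    then have "(1 - 2 / N) * (l - 1.3 / N\<^sup>2) \<le> weighted_log_cot (1 / N)"
      unfolding weighted_log_cot_def using N by (simp add: mult_left_mono)
    moreover have "(1 - 2 / N) * (1.3 / N\<^sup>2) \<le> 1 * (1.3 / N\<^sup>2)" using N by (intro mult_right_mono) auto
    ultimately show ?thesis by (simp add: right_diff_distrib)
  qed
  have "weighted_primitive (1 / N) \<le> weighted_primitive 0 + log_majorant_primitive (1 / N)" using weighted_primitive_increment_le[of "1 / N"] N by simp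
  then have "N * (2 * weighted_primitive (1 / N)) \<le> N * (2 * (weighted_primitive 0 + log_majorant_primitive (1 / N)))" using N by (intro mult_left_mono) auto
  moreover have "2 \<le> n" using n by simp
  note riemann_sum_weighted_log_cot_ge[OF this, folded N_def]
  ultimately have "(1 - 2 / N) * l - 1.3 / N\<^sup>2 - N * (2 * (weighted_primitive 0 + log_majorant_primitive (1 / N))) \<le> (\<Sum>j=1..<n. weighted_log_cot (real j / N))"
    using h_ge by linarith
  then have "N / 2 * ((1 - 2 / N) * l - 1.3 / N\<^sup>2 - N * (2 * (weighted_primitive 0 + log_majorant_primitive (1 / N))))
      \<le> N / 2 * (\<Sum>j=1..<n. weighted_log_cot (real j / N))"
    using N by (intro mult_left_mono) auto
  moreover have "N / 2 * ((1 - 2 / N) * l - 1.3 / N\<^sup>2 - N * (2 * (weighted_primitive 0 + log_majorant_primitive (1 / N))))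
      = c * N\<^sup>2 - N / 2 * l - N + 1/2 - 0.65 / N"
  proof -
    have H0: "2 * weighted_primitive 0 = - 2 * c" by (simp add: weighted_primitive_0 c_def)
    show ?thesis unfolding Q_eq distrib_left H0 using N by (simp add: field_simps power2_eq_square)
  qed
  moreover have "log_polygon_det n = N / 2 * (l + ln pi - ln 2) - N * (N - 1) / 2 * ln 2
      + N / 2 * (\<Sum>j=1..<n. weighted_log_cot (real j / N))"
    unfolding log_polygon_det_def ln_N[symmetric] by (simp add: N_def)
  moreover have "N / 2 * (l + ln pi - ln 2) - N * (N - 1) / 2 * ln 2 + (c * N\<^sup>2 - N / 2 * l - N + 1/2 - 0.65 / N)
    = (c - ln 2 / 2) * N\<^sup>2 - (1 - ln pi / 2) * N + 1/2 - 0.65 / N"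
    by (simp add: field_simps power2_eq_square)
  ultimately show ?thesis unfolding c_def N_def by linarith
qed

lemma ln_pi_ge: "ln pi \<ge> 1.098"
proof -
  have lower: "(\<Sum>k<4. 2*((3-1)/(3+1))^(2*k+1) / of_nat (2*k+1)) \<ge> (1.098 :: real)"
    by (simp add: lessThan_nat_numeral power_divide)
  have "(1::real) < 3" by simp
  note approx = ln_approx_bounds[OF this, of 4, unfolded atLeastAtMost_iff]
  have "1.098 \<le> ln (3::real)" by (rule order_trans[OF lower conjunct1[OF approx]])
  also have "\<dots> \<le> ln pi" using pi_gt3 by (intro ln_mono) auto
  finally show ?thesis .
qed

text \<open>The determinant is \<open>9/8\<close> for the triangle and \<open>cot\<^sup>2 (\<pi>/8) / 4\<close> for the square. From \<open>n = 5\<close> on, the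
  quadratic lower bound is positive.\<close>

lemma log_polygon_det_pos:
  assumes "n \<ge> 3"
  shows "log_polygon_det n > 0"
proof -
  consider "n = 3" | "n = 4" | "n \<ge> 5" using assms by linarith
  then show ?thesis
  proof cases
    case 1
    have "{1..<3::nat} = {1, 2}" by auto
    then have sum: "(\<Sum>j=1..<3. weighted_log_cot (real j / 3)) = weighted_log_cot (1/3) + weighted_log_cot (2/3)" by simp
    have h13: "weighted_log_cot (1/3) = ln 3 / 6"
      by (simp add: weighted_log_cot_def log_cot_def sin_30 cos_30 ln_div ln_sqrt)
    have h23: "weighted_log_cot (2/3) = ln 3 / 6" using weighted_log_cot_reflect[of "1/3"] h13 by simp
    have "log_polygon_det 3 = 3/2 * ln 3 - 3 * ln 2 + 3/2 * (weighted_log_cot (1/3) + weighted_log_cot (2/3))"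
      unfolding log_polygon_det_def using sum by simp
    then have "log_polygon_det 3 = 2 * ln 3 - 3 * ln 2" unfolding h13 h23 by simp
    moreover have "ln 8 < ln (9::real)" by simp
    moreover have "ln 8 = 3 * ln (2::real)" "ln 9 = 2 * ln (3::real)"
      using ln_realpow[of 2 3] ln_realpow[of 3 2] by simp_all
    ultimately show ?thesis using 1 by simp
  next
    case 2
    have "{1..<4::nat} = {1, 2, 3}" by auto
    then have sum: "(\<Sum>j=1..<4. weighted_log_cot (real j / 4)) = weighted_log_cot (1/4) + weighted_log_cot (1/2) + weighted_log_cot (3/4)" by simp
    have "weighted_log_cot (3/4) = weighted_log_cot (1/4)" using weighted_log_cot_reflect[of "1/4"] by simp
    moreover have "weighted_log_cot (1/2) = 0" by (simp add: weighted_log_cot_def)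
    ultimately have "log_polygon_det 4 = 2 * ln 4 - 6 * ln 2 + 4 * weighted_log_cot (1/4)"
      unfolding log_polygon_det_def using sum by simp
    moreover have "ln 4 = 2 * ln (2::real)" using ln_realpow[of 2 2] by simp
    moreover have "weighted_log_cot (1/4) > ln 2 / 2"
    proof -
      have p: "0 < sin (pi / 8)" "0 < cos (pi / 8)" using half_angle_pos[of "1/4"] by simp_all
      have "2 * (sin (pi / 8) * cos (pi / 8)) = sqrt 2 / 2"
        using sin_double[of "pi / 8"] by (simp add: sin_45)
      moreover have "2 * (cos (pi / 8))\<^sup>2 - 1 = sqrt 2 / 2"
        using cos_double_cos[of "pi / 8"] by (simp add: cos_45)
      moreover have "sqrt 2 < 2" using real_less_lsqrt[of 2 2] by simp
      ultimately have "2 * sin (pi / 8) * cos (pi / 8) < cos (pi / 8) * cos (pi / 8)"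
        by (simp add: power2_eq_square mult.assoc)
      then have "2 * sin (pi / 8) < cos (pi / 8)" using p by simp
      then have "ln (2 * sin (pi / 8)) < ln (cos (pi / 8))" using p by simp
      then have "ln 2 < log_cot (1/4)" using p by (simp add: log_cot_def ln_mult)
      then show ?thesis by (simp add: weighted_log_cot_def)
    qed
    ultimately show ?thesis using 2 by simp
  next
    case 3
    define N where "N = real n"
    have N: "N \<ge> 5" using 3 by (simp add: N_def)
    have c: "0.0797 \<le> 7 * riemann_zeta 3 / (2 * pi\<^sup>2) - ln 2 / 2"
      by (rule order_trans[OF _ limit_value_bounds(1)]) simp
    have l: "1 - ln pi / 2 \<le> 1 - 1.098 / 2" using ln_pi_ge by simp
    have "0.65 / N \<le> 0.65 / 5" using N by (intro divide_left_mono) auto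
    then have e: "0.65 / N \<le> 0.13" by simp
    \<comment> \<open>For \<open>n \<ge> 5\<close> the last error term is at most \<open>0.65/5 = 0.13\<close>.\<close>
    have "0.0797 * N\<^sup>2 - (1 - 1.098 / 2) * N + 1/2 - 0.13
      \<le> (7 * riemann_zeta 3 / (2 * pi\<^sup>2) - ln 2 / 2) * N\<^sup>2 - (1 - ln pi / 2) * N + 1/2 - 0.65 / N"
      using N by (intro add_mono diff_mono mult_right_mono c l e) auto
    also have "\<dots> \<le> log_polygon_det n" using log_polygon_det_ge[OF 3] by (simp add: N_def)
    finally have "0.0797 * N\<^sup>2 - (1 - 1.098 / 2) * N + 1/2 - 0.13 \<le> log_polygon_det n" .
    \<comment> \<open>The tangent to \<open>N\<^sup>2\<close> at \<open>5\<close> suffices, as the quadratic already increases there.\<close>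
    moreover have "0 \<le> (N - 5)\<^sup>2" by simp
    then have "10 * N - 25 \<le> N\<^sup>2" by (simp add: power2_diff)
    ultimately show ?thesis using N by simp
  qed
qed

lemma log_polygon_det_limit:
  "(\<lambda>n. log_polygon_det n / (real n)\<^sup>2) \<longlonglongrightarrow> 7 * riemann_zeta 3 / (2 * pi\<^sup>2) - ln 2 / 2"
proof -
  define c where "c = 7 * riemann_zeta 3 / (2 * pi\<^sup>2)"
  show ?thesis unfolding c_def[symmetric]
  proof (rule tendsto_sandwich)
    show "(\<lambda>n. (c - ln 2 / 2) - (1 - ln pi / 2) / real n + (1/2) / (real n)^2 - 0.65 / (real n) ^ 3)
        \<longlonglongrightarrow> c - ln 2 / 2" by real_asymp
    show "(\<lambda>n. c + ln (real n) / (2 * real n) - (1 - 1 / real n) * ln 2 / 2) \<longlonglongrightarrow> c - ln 2 / 2"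
      by real_asymp
    show "\<forall>\<^sub>F n in sequentially. (c - ln 2 / 2) - (1 - ln pi / 2) / real n + (1/2) / (real n)^2 - 0.65 / (real n) ^ 3
        \<le> log_polygon_det n / (real n)\<^sup>2"
      using eventually_ge_at_top[of 5]
    proof eventually_elim
      case (elim n)
      define N where "N = real n"
      have N: "N > 0" using elim by (simp add: N_def)
      have "(c - ln 2 / 2) - (1 - ln pi / 2) / N + (1/2) / N^2 - 0.65 / N ^ 3
        = ((c - ln 2 / 2) * N\<^sup>2 - (1 - ln pi / 2) * N + 1/2 - 0.65 / N) / N\<^sup>2"
        using N by (simp add: add_divide_distrib diff_divide_distrib power2_eq_square power3_eq_cube)
      also have "\<dots> \<le> log_polygon_det n / N\<^sup>2"
        using log_polygon_det_ge[OF elim] by (intro divide_right_mono) (auto simp: c_def N_def)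
      finally show ?case unfolding N_def .
    qed
    show "\<forall>\<^sub>F n in sequentially. log_polygon_det n / (real n)\<^sup>2
        \<le> c + ln (real n) / (2 * real n) - (1 - 1 / real n) * ln 2 / 2"
      using eventually_ge_at_top[of 1]
    proof eventually_elim
      case (elim n)
      define N where "N = real n"
      have N: "N > 0" using elim by (simp add: N_def)
      have "log_polygon_det n / N\<^sup>2 \<le> (c * N\<^sup>2 + N / 2 * ln N - N * (N - 1) / 2 * ln 2) / N\<^sup>2"
        using log_polygon_det_le[OF elim] by (intro divide_right_mono) (auto simp: c_def N_def)
      also have "\<dots> = c + ln N / (2 * N) - (1 - 1 / N) * ln 2 / 2"
        using N by (simp add: field_simps power2_eq_square)
      finally show ?case unfolding N_def .
    qed
  qed
qed
lemma cmod_atiyah_det_eq_exp: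
  assumes "n \<ge> 2" "regular_polygon_vertices n x"
  shows "cmod (atiyah_det n x) = exp (log_polygon_det n)"
proof -
  have n: "real n > 0" using assms by simp
  have K: "sqrt (real n) / sqrt 2 ^ (n - 1) = exp (ln (real n) / 2 - (real n - 1) / 2 * ln 2)"
  proof -
    have "sqrt (real n) = exp (ln (real n) / 2)" using n by (simp add: ln_sqrt[symmetric])
    moreover have "sqrt 2 ^ (n - 1) = exp ((real n - 1) / 2 * ln 2)"
    proof -
      have "sqrt 2 ^ (n - 1) = exp (real (n - 1) * ln (sqrt 2))" by (simp add: exp_of_nat_mult)
      then show ?thesis using assms by (simp add: ln_sqrt of_nat_diff)
    qed
    ultimately show ?thesis by (simp add: exp_diff)
  qed
  have "cmod (atiyah_det n x) = (\<Prod>m<n. exp (ln (real n) / 2 - (real n - 1) / 2 * ln 2 + (\<Sum>j=1..m. log_cot (real j / real n))))"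
    unfolding cmod_atiyah_det_regular_polygon[OF assms] K
    by (intro prod.cong) (simp_all add: cmod_gauss_poly_coeff exp_add)
  also have "\<dots> = exp (\<Sum>m<n. ln (real n) / 2 - (real n - 1) / 2 * ln 2 + (\<Sum>j=1..m. log_cot (real j / real n)))"
    by (simp add: exp_sum)
  also have "(\<Sum>m<n. ln (real n) / 2 - (real n - 1) / 2 * ln 2 + (\<Sum>j=1..m. log_cot (real j / real n))) = log_polygon_det n"
    unfolding sum.distrib double_sum_log_cot log_polygon_det_def by (simp add: algebra_simps)
  finally show ?thesis .
qed

theorem theorem2p8:
  fixes x :: "nat \<Rightarrow> nat \<Rightarrow> real ^ 3"
  assumes "\<And>n. n \<ge> 3 \<Longrightarrow> regular_polygon_vertices n (x n)"
  shows "((\<lambda>n. ln (cmod (atiyah_det n (x n))) / (real n)\<^sup>2)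
            \<longlonglongrightarrow> 7 * riemann_zeta 3 / (2 * pi\<^sup>2) - ln 2 / 2)
    \<and> 0.07970480 \<le> 7 * riemann_zeta 3 / (2 * pi\<^sup>2) - ln 2 / 2
    \<and> 7 * riemann_zeta 3 / (2 * pi\<^sup>2) - ln 2 / 2 < 0.07970481
    \<and> (\<forall>n\<ge>3. cmod (atiyah_det n (x n)) > 1)"
proof (intro conjI allI impI limit_value_bounds)
  have D: "cmod (atiyah_det n (x n)) = exp (log_polygon_det n)" if "n \<ge> 3" for n
    using cmod_atiyah_det_eq_exp[OF _ assms[OF that]] that by simp
  have "\<forall>\<^sub>F n in sequentially. log_polygon_det n / (real n)\<^sup>2 = ln (cmod (atiyah_det n (x n))) / (real n)\<^sup>2"
    using eventually_ge_at_top[of 3] by eventually_elim (simp add: D)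
  then show "(\<lambda>n. ln (cmod (atiyah_det n (x n))) / (real n)\<^sup>2)
            \<longlonglongrightarrow> 7 * riemann_zeta 3 / (2 * pi\<^sup>2) - ln 2 / 2"
    using log_polygon_det_limit by (rule Lim_transform_eventually[rotated])
  show "cmod (atiyah_det n (x n)) > 1" if "n \<ge> 3" for n
    using log_polygon_det_pos[OF that] D[OF that] by simp
qed

end
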